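(* The problem point-restless-temporal-path (given a point temporal graph $G=(V,E)$ with arbitrary positive delays, a source $s\in V$, a target $t\in V$ and $\Delta\in\mathbb{N}$, decide whether there is a $\Delta$-restless temporal path from $s$ to $t$ in $G$) can be solved in $\mathcal{O}(Mk2^k(k+\log M))$ deterministic time, where $M=|E|$ and $k$ is the vertex-interval-membership-width of $G$.
   Context: A point temporal graph $G=(V,E)$ consists of a finite set of nodes $V$ and a finite set of timed arcs $E\subseteq V\times V\times\mathbb{N}\times\mathbb{N}_{>0}$; a timed arc $(u,v,\tau,\delta)$ has appearance time $\tau$, delay $\delta>0$ and arrival time $\tau+\delta$. The lifetime is $\Lambda=\max\{\tau+\delta:(u,v,\tau,\delta)\in E\}$. The input is given as the list of timed arcs sorted by non-decreasing appearance time. A temporal path from $s=v_0$ to $t=v_\ell$ is a sequence of timed arcs $(v_{i-1},v_i,\tau_i,\delta_i)_{i=1,\dots,\ell}$ in $E$ with $\tau_i+\delta_i\le\tau_{i+1}$ for $1\le i\le\ell-1$ and $v_0,\dots,v_\ell$ pairwise distinct; it is $\Delta$-restless if $\tau_{i+1}-(\tau_i+\delta_i)\le\Delta$ for $1\le i\le\ell-1$. For $u\in V$ let $\tau^{min}(u)$ be the minimum appearance time of a timed arc having $u$ as an endpoint, and $\tau^{max}(u)$ the maximum arrival time of a timed arc having $u$ as an endpoint. For $\tau\in\{0,\dots,\Lambda\}$ let $F_\tau=\{u\in V:\tau^{min}(u)\le\tau\le\tau^{max}(u)\}$. The vertex-interval-membership-width of $G$ is $\max_{\tau\in\{0,\dots,\Lambda\}}|F_\tau|$.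 *)

theory Defs
  imports Complex_Main
begin

section \<open>Point temporal graphs\<close>

text \<open>A timed arc is a tuple \<open>(u, v, \<tau>, \<delta>)\<close>.\<close>

type_synonym 'v tarc = "'v \<times> 'v \<times> nat \<times> nat"

fun tail :: "'v tarc \<Rightarrow> 'v" where "tail (u, v, \<tau>, \<delta>) = u"
fun head :: "'v tarc \<Rightarrow> 'v" where "head (u, v, \<tau>, \<delta>) = v"
fun appearance :: "'v tarc \<Rightarrow> nat" where "appearance (u, v, \<tau>, \<delta>) = \<tau>"
fun delay :: "'v tarc \<Rightarrow> nat" where "delay (u, v, \<tau>, \<delta>) = \<delta>"

definition arrival :: "'v tarc \<Rightarrow> nat" where
  "arrival e = appearance e + delay e"

definition endpoint :: "'v \<Rightarrow> 'v tarc \<Rightarrow> bool" where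
  "endpoint u e \<longleftrightarrow> u = tail e \<or> u = head e"

definition point_temporal_graph :: "'v set \<Rightarrow> 'v tarc set \<Rightarrow> bool" where
  "point_temporal_graph V E \<longleftrightarrow>
     finite V \<and> finite E \<and> (\<forall>e\<in>E. tail e \<in> V \<and> head e \<in> V \<and> delay e > 0)"

text \<open>
  The node sequence \<open>v\<^sub>0, \<dots>, v\<^sub>\<ell>\<close> of a path is \<open>s # map head p\<close>. The empty
  arc sequence (\<open>\<ell> = 0\<close>) is a temporal path from each node to itself.
\<close>

definition temporal_path :: "'v tarc set \<Rightarrow> 'v \<Rightarrow> 'v \<Rightarrow> 'v tarc list \<Rightarrow> bool" where
  "temporal_path E s t p \<longleftrightarrow>
     set p \<subseteq> E \<and>
     (\<forall>i<length p. tail (p ! i) = (s # map head p) ! i) \<and>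
     last (s # map head p) = t \<and>
     (\<forall>i. Suc i < length p \<longrightarrow> arrival (p ! i) \<le> appearance (p ! Suc i)) \<and>
     distinct (s # map head p)"

text \<open>
  The subtraction on \<^typ>\<open>nat\<close> below is exact for temporal paths, where
  \<open>arrival (p ! i) \<le> appearance (p ! Suc i)\<close>.
\<close>

definition restless :: "nat \<Rightarrow> 'v tarc list \<Rightarrow> bool" where
  "restless \<Delta> p \<longleftrightarrow>
     (\<forall>i. Suc i < length p \<longrightarrow> appearance (p ! Suc i) - arrival (p ! i) \<le> \<Delta>)"


section \<open>Vertex-interval-membership-width\<close>

text \<open>Arrival times are positive, so inserting \<open>0\<close> only fixes the value for \<open>E = {}\<close>.\<close>

definition lifetime :: "'v tarc set \<Rightarrow> nat" where
  "lifetime E = Max (insert 0 (arrival ` E))"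

definition tau_min :: "'v tarc set \<Rightarrow> 'v \<Rightarrow> nat" where
  "tau_min E u = Min {appearance e |e. e \<in> E \<and> endpoint u e}"

definition tau_max :: "'v tarc set \<Rightarrow> 'v \<Rightarrow> nat" where
  "tau_max E u = Max {arrival e |e. e \<in> E \<and> endpoint u e}"

text \<open>
  \<^const>\<open>tau_min\<close> and \<^const>\<open>tau_max\<close> are meaningless for a node that is not an endpoint
  of any arc; such a node has an empty interval and belongs to no \<open>F\<^sub>\<tau>\<close>.
\<close>

definition active_nodes :: "'v set \<Rightarrow> 'v tarc set \<Rightarrow> nat \<Rightarrow> 'v set" where
  "active_nodes V E \<tau> =
     {u \<in> V. (\<exists>e\<in>E. endpoint u e) \<and> tau_min E u \<le> \<tau> \<and> \<tau> \<le> tau_max E u}"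

definition vimw :: "'v set \<Rightarrow> 'v tarc set \<Rightarrow> nat" where
  "vimw V E = Max ((\<lambda>\<tau>. card (active_nodes V E \<tau>)) ` {0..lifetime E})"


section \<open>A deterministic word RAM\<close>

text \<open>
  Programs are structured programs over registers \<open>0, 1, 2, \<dots>\<close> (only finitely many of
  which are named by a given program) and a random-access memory. The unit-cost
  instructions are the ones of the usual word RAM: constants, \<open>+\<close>, truncated \<open>-\<close>, \<open>*\<close>,
  integer division, comparisons, indirect loads and stores; a test costs one unit too.
  Conditionals and loops translate to a constant number of jump instructions, so running
  times agree with those of the RAM with jumps up to a constant factor.

  \<open>exec w P \<sigma> T \<sigma>'\<close> states that \<open>P\<close>, started in \<open>\<sigma>\<close> on a machine with \<open>w\<close>-bit
  words, halts in \<open>\<sigma>'\<close> after exactly \<open>T\<close> steps. An instruction whose result does not fit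
  into a word has no successor state, so no use can be made of larger numbers.
\<close>

datatype binop = Add | Sub | Mul | Div | Less | Equal

fun eval_binop :: "binop \<Rightarrow> nat \<Rightarrow> nat \<Rightarrow> nat" where
  "eval_binop Add x y = x + y"
| "eval_binop Sub x y = x - y"
| "eval_binop Mul x y = x * y"
| "eval_binop Div x y = x div y"
| "eval_binop Less x y = (if x < y then 1 else 0)"
| "eval_binop Equal x y = (if x = y then 1 else 0)"

type_synonym reg = nat

datatype program =
    Skip
  | Const reg nat               \<comment> \<open>\<open>r := n\<close>\<close>
  | Op binop reg reg reg        \<comment> \<open>\<open>r := a \<circ> b\<close>\<close>
  | Load reg reg                \<comment> \<open>\<open>r := mem[a]\<close>\<close>
  | Store reg reg               \<comment> \<open>\<open>mem[a] := b\<close>\<close>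
  | Seq program program
  | Cond reg program program    \<comment> \<open>\<open>if r \<noteq> 0 then P else Q\<close>\<close>
  | Loop reg program            \<comment> \<open>\<open>while r \<noteq> 0 do P\<close>\<close>

type_synonym state = "(nat \<Rightarrow> nat) \<times> (nat \<Rightarrow> nat)"  \<comment> \<open>registers and memory\<close>

inductive exec :: "nat \<Rightarrow> program \<Rightarrow> state \<Rightarrow> nat \<Rightarrow> state \<Rightarrow> bool" for w :: nat where
  Skip: "exec w Skip \<sigma> 1 \<sigma>"
| Const: "n < 2 ^ w \<Longrightarrow> exec w (Const r n) (R, M) 1 (R(r := n), M)"
| Op: "eval_binop f (R a) (R b) < 2 ^ w \<Longrightarrow>
    exec w (Op f r a b) (R, M) 1 (R(r := eval_binop f (R a) (R b)), M)"
| Load: "M (R a) < 2 ^ w \<Longrightarrow> exec w (Load r a) (R, M) 1 (R(r := M (R a)), M)"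
| Store: "exec w (Store a b) (R, M) 1 (R, M(R a := R b))"
| Seq: "exec w P \<sigma> T \<sigma>' \<Longrightarrow> exec w Q \<sigma>' T' \<sigma>'' \<Longrightarrow> exec w (Seq P Q) \<sigma> (T + T') \<sigma>''"
| CondTrue: "R r \<noteq> 0 \<Longrightarrow> exec w P (R, M) T \<sigma> \<Longrightarrow> exec w (Cond r P Q) (R, M) (1 + T) \<sigma>"
| CondFalse: "R r = 0 \<Longrightarrow> exec w Q (R, M) T \<sigma> \<Longrightarrow> exec w (Cond r P Q) (R, M) (1 + T) \<sigma>"
| LoopTrue: "R r \<noteq> 0 \<Longrightarrow> exec w P (R, M) T \<sigma> \<Longrightarrow> exec w (Loop r P) \<sigma> T' \<sigma>' \<Longrightarrow>
    exec w (Loop r P) (R, M) (1 + T + T') \<sigma>'"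
| LoopFalse: "R r = 0 \<Longrightarrow> exec w (Loop r P) (R, M) 1 (R, M)"

inductive_cases exec_SkipE: "exec w Skip \<sigma> T \<sigma>'"
inductive_cases exec_ConstE: "exec w (Const r n) \<sigma> T \<sigma>'"
inductive_cases exec_OpE: "exec w (Op f r a b) \<sigma> T \<sigma>'"
inductive_cases exec_LoadE: "exec w (Load r a) \<sigma> T \<sigma>'"
inductive_cases exec_StoreE: "exec w (Store a b) \<sigma> T \<sigma>'"
inductive_cases exec_SeqE: "exec w (Seq P Q) \<sigma> T \<sigma>'"
inductive_cases exec_CondE: "exec w (Cond r P Q) \<sigma> T \<sigma>'"
inductive_cases exec_LoopE: "exec w (Loop r P) \<sigma> T \<sigma>'"

lemma exec_deterministic:
  "exec w P \<sigma> T \<sigma>' \<Longrightarrow> exec w P \<sigma> T' \<sigma>'' \<Longrightarrow> T' = T \<and> \<sigma>'' = \<sigma>'"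
proof (induction arbitrary: T' \<sigma>'' rule: exec.induct)
  case (Seq P \<sigma> T1 \<sigma>1 Q T2 \<sigma>2)
  from Seq.prems obtain U1 U2 \<sigma>3
    where *: "T' = U1 + U2" "exec w P \<sigma> U1 \<sigma>3" "exec w Q \<sigma>3 U2 \<sigma>''"
    by (rule exec_SeqE)
  then have "U1 = T1" "\<sigma>3 = \<sigma>1" using Seq.IH(1) by simp_all
  with * Seq.IH(2) show ?case by simp
next
  case (LoopTrue R r P M T1 \<sigma>1 T2 \<sigma>2)
  from LoopTrue.prems obtain U1 U2 \<sigma>3
    where *: "T' = 1 + U1 + U2" "exec w P (R, M) U1 \<sigma>3" "exec w (Loop r P) \<sigma>3 U2 \<sigma>''"
    by (rule exec_LoopE) (use LoopTrue.hyps(1) in simp_all)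
  then have "U1 = T1" "\<sigma>3 = \<sigma>1" using LoopTrue.IH(1) by simp_all
  with * LoopTrue.IH(2) show ?case by simp
next
  case Skip from Skip.prems show ?case by (rule exec_SkipE) simp
next
  case Const from Const.prems show ?case by (rule exec_ConstE) simp
next
  case Op from Op.prems show ?case by (rule exec_OpE) simp
next
  case Load from Load.prems show ?case by (rule exec_LoadE) simp
next
  case Store from Store.prems show ?case by (rule exec_StoreE) simp
next
  case CondTrue
  from CondTrue.prems show ?case by (rule exec_CondE) (use CondTrue.hyps(1) CondTrue.IH in simp_all)
next
  case CondFalse
  from CondFalse.prems show ?case by (rule exec_CondE) (use CondFalse.hyps(1) CondFalse.IH in simp_all)
next
  case LoopFalse
  from LoopFalse.prems show ?case by (rule exec_LoopE) (use LoopFalse.hyps in simp_all)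
qed


section \<open>Instances as machine inputs\<close>

text \<open>
  Node names are words. An instance is presented as \<open>M, \<Delta>, s, t\<close> followed by the four
  words of each timed arc, the arcs being listed without repetition by non-decreasing
  appearance time (with ties in any order). The input occupies the memory cells from
  \<open>0\<close> on; all other cells and all registers are initially \<open>0\<close>.
\<close>

definition arc_listing :: "'v tarc set \<Rightarrow> 'v tarc list \<Rightarrow> bool" where
  "arc_listing E es \<longleftrightarrow> set es = E \<and> distinct es \<and> sorted (map appearance es)"

definition encode :: "nat tarc list \<Rightarrow> nat \<Rightarrow> nat \<Rightarrow> nat \<Rightarrow> nat list" where
  "encode es \<Delta> s t =
     [length es, \<Delta>, s, t] @ concat (map (\<lambda>(u, v, \<tau>, \<delta>). [u, v, \<tau>, \<delta>]) es)"

definition initial_state :: "nat list \<Rightarrow> state" where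
  "initial_state xs = (\<lambda>_. 0, \<lambda>i. if i < length xs then xs ! i else 0)"

text \<open>Register \<open>0\<close> holds the answer when the program halts.\<close>

definition answer :: "state \<Rightarrow> nat" where
  "answer \<sigma> = fst \<sigma> 0"

text \<open>
  Word sizes \<open>w = \<Omega>(k + log N)\<close>, with \<open>N\<close> the largest input number (hence \<open>N \<ge> M\<close>): words
  can hold the input numbers and the addresses of \<open>2\<^sup>k poly(M)\<close> memory cells.
\<close>

definition word_size_ok :: "nat \<Rightarrow> nat \<Rightarrow> nat list \<Rightarrow> nat \<Rightarrow> bool" where
  "word_size_ok c k xs w \<longleftrightarrow> real w \<ge> real c * (real k + log 2 (2 + real (Max (set xs))))"

end

theory Submission
  imports Defs "HOL-Library.Nat_Bijection"
begin

text \<open>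
  A dynamic program over the arcs in the given order. Call a node live at position \<open>j\<close> if it is an
  endpoint of some arc up to \<open>j\<close> and of some arc from \<open>j\<close> on. Live nodes lie in a common \<open>F\<^sub>\<tau>\<close>, so
  there are at most \<open>k\<close> of them and a greedy interval colouring gives nodes that are live together
  different colours below \<open>k\<close>. When arc \<open>j\<close> is processed, a partial path is represented by its
  arrival time at the tail of \<open>j\<close> and by the set of colours of its visited live nodes: a node that
  is not live any more will not be met again, and the head of \<open>j\<close> is live. For each of the at most
  \<open>2\<^sup>k\<close> sets only the latest arrival time matters. An entry is passed on to the next arc with the
  same tail and, if the arc can be appended, to the first arc leaving its head that does not
  depart before the arrival; this arc is found by binary search. Colours whose node ceases to be live in between
  are dropped from the set, which takes \<open>O(k)\<close> steps per set, so an arc costs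
  \<open>O(2\<^sup>k k + log M)\<close>.
\<close>

section \<open>A while language for the word RAM\<close>

text \<open>Keeping only the latest arrival is safe because of where an entry sits: it is stored at
  an arc that departs no earlier than the arrival, so only the upper bound \<open>\<Delta>\<close>
  on the waiting time remains to be checked, and a later arrival can only help with it. Handing
  entries from arc to arc limits the work to two table updates per arc and set, however many arcs
  leave a node within \<open>\<Delta>\<close> time units. The machine does not know
  \<open>k\<close>. Colours are opened on demand, and the number \<open>K \<le> k\<close> actually
  opened fixes the number \<open>2 ^ K\<close> of table rows; colour sets are binary numbers that
  index these rows. Node names are arbitrary words, so arrays indexed by names could not be cleared
  within a time bound in \<open>M\<close> and \<open>k\<close>. The initial 0 of every cell
  therefore has to mean "absent". Hence the non-zero encodings: arrival time plus one, last position
  plus one, \<open>n - i\<close> for position \<open>i\<close>, and \<open>2 ^ b\<close> for colour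
  \<open>b\<close>.\<close>

datatype expr =
    Lit nat
  | Var reg
  | Bin binop expr expr
  | Input expr
  | Cell nat expr expr

datatype com =
    Nop
  | Assign reg expr            ("_ ::= _" [1000, 61] 61)
  | Put nat expr expr expr
  | Then com com               (infixr ";;" 60)
  | IfC expr com com           ("IF _ THEN _ ELSE _" [0, 0, 61] 61)
  | While expr com             ("WHILE _ DO _" [0, 61] 61)

text \<open>
  Registers below 60 are the program variables. Registers 60, 61 and 62 hold the base address \<open>B\<close>
  of the work space, the row length \<open>D\<close> and \<open>0\<close>; expressions are evaluated on a stack of registers
  from 64 on. The cells \<open>(i, j)\<close> of up to 16 arrays \<open>c\<close> are interleaved at \<open>(i D + j) 16 + B + c\<close>.
\<close>

fun address :: "nat \<Rightarrow> nat \<Rightarrow> program" where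
  "address c d =
     Seq (Op Mul d d 61) (Seq (Op Add d d (Suc d)) (Seq (Const (Suc d) 16)
       (Seq (Op Mul d d (Suc d)) (Seq (Op Add d d 60) (Seq (Const (Suc d) c) (Op Add d d (Suc d)))))))"

text \<open>The machine has no move instruction; adding register 62, which holds 0, copies a
  register.\<close>

primrec compile_expr :: "expr \<Rightarrow> reg \<Rightarrow> program" where
  "compile_expr (Lit n) d = Const d n"
| "compile_expr (Var x) d = Op Add d x 62"
| "compile_expr (Bin f a b) d = Seq (compile_expr a d) (Seq (compile_expr b (Suc d)) (Op f d d (Suc d)))"
| "compile_expr (Input a) d = Seq (compile_expr a d) (Load d d)"
| "compile_expr (Cell c a b) d =
     Seq (compile_expr a d) (Seq (compile_expr b (Suc d)) (Seq (address c d) (Load d d)))"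

primrec expr_cost :: "expr \<Rightarrow> nat" where
  "expr_cost (Lit n) = 1"
| "expr_cost (Var x) = 1"
| "expr_cost (Bin f a b) = expr_cost a + expr_cost b + 1"
| "expr_cost (Input a) = expr_cost a + 1"
| "expr_cost (Cell c a b) = expr_cost a + expr_cost b + 8"

primrec compile :: "com \<Rightarrow> program" where
  "compile Nop = Skip"
| "compile (x ::= e) = Seq (compile_expr e 64) (Op Add x 64 62)"
| "compile (Put c a b e) =
     Seq (compile_expr a 64) (Seq (compile_expr b 65) (Seq (address c 64)
       (Seq (compile_expr e 65) (Store 64 65))))"
| "compile (P ;; Q) = Seq (compile P) (compile Q)"
| "compile (IF e THEN P ELSE Q) = Seq (compile_expr e 64) (Cond 64 (compile P) (compile Q))"
| "compile (WHILE e DO P) =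
     Seq (compile_expr e 64) (Loop 64 (Seq (compile P) (compile_expr e 64)))"

type_synonym arrays = "nat \<Rightarrow> nat \<Rightarrow> nat \<Rightarrow> nat"
text \<open>The first component of a state is a clock.\<close>

type_synonym timed_state = "nat \<times> (reg \<Rightarrow> nat) \<times> arrays"

abbreviation (input) upd :: "arrays \<Rightarrow> nat \<Rightarrow> nat \<Rightarrow> nat \<Rightarrow> nat \<Rightarrow> arrays" where
  "upd A c i j x \<equiv> A(c := (A c)(i := (A c i)(j := x)))"

section \<open>Arrays and expressions on the word RAM\<close>

locale machine =
  fixes w :: nat and inp :: "nat \<Rightarrow> nat" and B D Z :: nat
  assumes D_le: "D \<le> Z"
    and capacity: "(Z * D + D) * 16 + 16 + B < 2 ^ w"
    and inp_fits: "i < B \<Longrightarrow> inp i < 2 ^ w"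
begin

primrec val :: "expr \<Rightarrow> (reg \<Rightarrow> nat) \<Rightarrow> arrays \<Rightarrow> nat" where
  "val (Lit n) R A = n"
| "val (Var x) R A = R x"
| "val (Bin f a b) R A = eval_binop f (val a R A) (val b R A)"
| "val (Input a) R A = inp (val a R A)"
| "val (Cell c a b) R A = A c (val a R A) (val b R A)"

text \<open>Only \<open>Add\<close> and \<open>Mul\<close> need an overflow check: the other
  operations yield at most their first operand or a truth value.\<close>

primrec ok :: "expr \<Rightarrow> (reg \<Rightarrow> nat) \<Rightarrow> arrays \<Rightarrow> bool" where
  "ok (Lit n) R A \<longleftrightarrow> n < 2 ^ w"
| "ok (Var x) R A \<longleftrightarrow> x < 60"
| "ok (Bin f a b) R A \<longleftrightarrow> ok a R A \<and> ok b R A \<and>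
     (f = Add \<or> f = Mul \<longrightarrow> eval_binop f (val a R A) (val b R A) < 2 ^ w)"
| "ok (Input a) R A \<longleftrightarrow> ok a R A \<and> val a R A < B"
| "ok (Cell c a b) R A \<longleftrightarrow> ok a R A \<and> ok b R A \<and> c < 16 \<and> val a R A < Z \<and> val b R A < D"

definition loc :: "nat \<Rightarrow> nat \<Rightarrow> nat \<Rightarrow> nat" where
  "loc c i j = (i * D + j) * 16 + B + c"

text \<open>Rows \<open>i\<close> are unbounded here, since memory is a total function; a bound on
  the row is demanded only where a cell is accessed.\<close>

definition represents :: "state \<Rightarrow> (reg \<Rightarrow> nat) \<Rightarrow> arrays \<Rightarrow> bool" where
  "represents \<sigma> R A \<longleftrightarrow>
     (\<forall>r<60. fst \<sigma> r = R r \<and> R r < 2 ^ w) \<and>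
     fst \<sigma> 60 = B \<and> fst \<sigma> 61 = D \<and> fst \<sigma> 62 = 0 \<and>
     (\<forall>i<B. snd \<sigma> i = inp i) \<and>
     (\<forall>c<16. \<forall>i. \<forall>j<D. snd \<sigma> (loc c i j) = A c i j \<and> A c i j < 2 ^ w)"

lemma loc_less: "c < 16 \<Longrightarrow> i < Z \<Longrightarrow> j < D \<Longrightarrow> loc c i j < 2 ^ w"
proof -
  assume a: "c < 16" "i < Z" "j < D"
  have "i * D + j \<le> Z * D + D" using a by (intro add_mono mult_le_mono) auto
  then have "(i * D + j) * 16 \<le> (Z * D + D) * 16" by (rule mult_le_mono1)
  then show ?thesis using a(1) capacity unfolding loc_def by linarith
qed

lemma loc_ge: "B \<le> loc c i j"
  by (simp add: loc_def)

lemma loc_inject: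
  assumes "c < 16" "c' < 16" "j < D" "j' < D" "loc c i j = loc c' i' j'"
  shows "c = c' \<and> i = i' \<and> j = j'"
proof -
  have eq: "(i * D + j) * 16 + c = (i' * D + j') * 16 + c'"
    using assms(5) by (simp add: loc_def)
  then have "((i * D + j) * 16 + c) mod 16 = ((i' * D + j') * 16 + c') mod 16" by (rule arg_cong)
  then have c: "c = c'" using assms(1,2) by (simp only: mod_mult_self3 mod_less)
  with eq have "i * D + j = i' * D + j'" by simp
  then have "(i * D + j) div D = (i' * D + j') div D" "(i * D + j) mod D = (i' * D + j') mod D"
    by simp_all
  with c assms(3,4) show ?thesis by simp
qed

lemma exec_address:
  assumes "R d = i" "R (Suc d) = j" "R 60 = B" "R 61 = D" "c < 16" "i < Z" "j < D" "64 \<le> d"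
  shows "\<exists>R'. exec w (address c d) (R, M) 7 (R', M) \<and> R' d = loc c i j \<and> (\<forall>r<d. R' r = R r)"
proof -
  \<comment> \<open>Every intermediate sum and product is at most the final address, so the one
    bound on \<open>loc\<close> covers all the arithmetic.\<close>
  have bound: "(y + j) * 16 + B + c < 2 ^ w \<Longrightarrow> y < 2 ^ w \<and> y + j < 2 ^ w \<and>
      (y + j) * 16 < 2 ^ w \<and> (y + j) * 16 + B < 2 ^ w" for y
    by simp
  have l: "loc c i j < 2 ^ w" using assms loc_less by blast
  have b: "i * D < 2 ^ w" "i * D + j < 2 ^ w" "(i * D + j) * 16 < 2 ^ w"
    "(i * D + j) * 16 + B < 2 ^ w"
    using bound[of "i * D"] l unfolding loc_def by blast+
  have c: "16 < (2::nat) ^ w" using capacity by linarith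
  define R1 where "R1 = R(d := i * D)"
  define R2 where "R2 = R1(d := i * D + j)"
  define R3 where "R3 = R2(Suc d := 16)"
  define R4 where "R4 = R3(d := (i * D + j) * 16)"
  define R5 where "R5 = R4(d := (i * D + j) * 16 + B)"
  define R6 where "R6 = R5(Suc d := c)"
  define R7 where "R7 = R6(d := loc c i j)"
  note defs = R1_def R2_def R3_def R4_def R5_def R6_def R7_def
  have "exec w (Op Mul d d 61) (R, M) 1 (R1, M)"
    using exec.Op[of Mul R d 61 w d M] assms b by (simp add: defs)
  moreover have "exec w (Op Add d d (Suc d)) (R1, M) 1 (R2, M)"
    using exec.Op[of Add R1 d "Suc d" w d M] assms b by (simp add: defs)
  moreover have "exec w (Const (Suc d) 16) (R2, M) 1 (R3, M)"
    using exec.Const[of 16 w "Suc d" R2 M] c by (simp add: defs)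
  moreover have "exec w (Op Mul d d (Suc d)) (R3, M) 1 (R4, M)"
    using exec.Op[of Mul R3 d "Suc d" w d M] assms b by (simp add: defs)
  moreover have "exec w (Op Add d d 60) (R4, M) 1 (R5, M)"
    using exec.Op[of Add R4 d "60" w d M] assms b by (simp add: defs)
  moreover have "exec w (Const (Suc d) c) (R5, M) 1 (R6, M)"
    using exec.Const[of c w "Suc d" R5 M] c assms by (simp add: defs)
  moreover have "exec w (Op Add d d (Suc d)) (R6, M) 1 (R7, M)"
    using exec.Op[of Add R6 d "Suc d" w d M] assms l by (simp add: defs loc_def)
  ultimately have "exec w (address c d) (R, M) (1 + (1 + (1 + (1 + (1 + (1 + 1)))))) (R7, M)"
    unfolding address.simps by (intro exec.Seq)
  then show ?thesis by (intro exI[of _ R7]) (simp add: defs numeral_eq_Suc)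
qed

lemma eval_binop_less:
  assumes "x < 2 ^ w" "y < 2 ^ w" "f = Add \<or> f = Mul \<longrightarrow> eval_binop f x y < 2 ^ w"
  shows "eval_binop f x y < 2 ^ w"
proof (cases f)
  case Div
  have "x div y \<le> x" by (rule div_le_dividend)
  then show ?thesis using Div assms(1) by (simp del: div_le_dividend)
next
  case Less
  have "16 < (2::nat) ^ w" using capacity by linarith
  with Less show ?thesis by simp
next
  case Equal
  have "16 < (2::nat) ^ w" using capacity by linarith
  with Equal show ?thesis by simp
qed (use assms in auto)

text \<open>Preservation of all registers below \<open>d\<close> is the stack discipline: it
  protects the left operand while the right one is evaluated one register higher, and it protects
  the program variables.\<close>

lemma exec_expr:
  assumes "represents (R', M) R A" "ok e R A" "64 \<le> d"
  shows "\<exists>R''. exec w (compile_expr e d) (R', M) (expr_cost e) (R'', M) \<and>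
    R'' d = val e R A \<and> val e R A < 2 ^ w \<and> (\<forall>r<d. R'' r = R' r)"
  using assms
proof (induction e arbitrary: d R')
  case (Lit n)
  then show ?case by (intro exI[of _ "R'(d := n)"]) (use exec.Const[of n w d R' M] in \<open>simp_all del: fun_upd_apply\<close>, simp_all)
next
  case (Var x)
  then have "R' x = R x" "R x < 2 ^ w" "R' 62 = 0" by (auto simp: represents_def)
  with Var show ?case
    by (intro exI[of _ "R'(d := R x)"])
      (use exec.Op[of Add R' x 62 w d M] in \<open>simp_all del: fun_upd_apply\<close>, simp_all)
next
  case (Bin f a b)
  from Bin.prems Bin.IH(1)[of R' d] obtain R1 where R1:
    "exec w (compile_expr a d) (R', M) (expr_cost a) (R1, M)"
    "R1 d = val a R A" "val a R A < 2 ^ w" "\<forall>r<d. R1 r = R' r" by auto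
  have "represents (R1, M) R A" using Bin.prems(1,3) R1(4) by (auto simp: represents_def)
  with Bin.prems Bin.IH(2)[of R1 "Suc d"] obtain R2 where R2:
    "exec w (compile_expr b (Suc d)) (R1, M) (expr_cost b) (R2, M)"
    "R2 (Suc d) = val b R A" "val b R A < 2 ^ w" "\<forall>r<Suc d. R2 r = R1 r" by auto
  define x where "x = eval_binop f (val a R A) (val b R A)"
  have x: "x < 2 ^ w" unfolding x_def using Bin.prems R1 R2 by (intro eval_binop_less) auto
  have "exec w (Op f d d (Suc d)) (R2, M) 1 (R2(d := x), M)"
    using exec.Op[of f R2 d "Suc d" w d M] R1 R2 x by (simp add: x_def)
  with R1 R2 have "exec w (compile_expr (Bin f a b) d) (R', M)
      (expr_cost a + (expr_cost b + 1)) (R2(d := x), M)"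
    unfolding compile_expr.simps by (intro exec.Seq)
  moreover have "expr_cost (Bin f a b) = expr_cost a + (expr_cost b + 1)" by simp
  ultimately show ?case using R1 R2 x
    by (intro exI[of _ "R2(d := x)"] conjI) (simp_all only:, auto simp: x_def)
next
  case (Input a)
  from Input.prems Input.IH[of R' d] obtain R1 where R1:
    "exec w (compile_expr a d) (R', M) (expr_cost a) (R1, M)"
    "R1 d = val a R A" "val a R A < 2 ^ w" "\<forall>r<d. R1 r = R' r" by auto
  have v: "M (R1 d) = inp (val a R A)" using Input.prems R1(2) by (auto simp: represents_def)
  have "inp (val a R A) < 2 ^ w" using Input.prems inp_fits by auto
  with v have "exec w (Load d d) (R1, M) 1 (R1(d := inp (val a R A)), M)"
    using exec.Load[of M R1 d w d] by simp
  with R1 have "exec w (compile_expr (Input a) d) (R', M) (expr_cost a + 1)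
      (R1(d := inp (val a R A)), M)"
    unfolding compile_expr.simps by (intro exec.Seq)
  then show ?case using R1 \<open>inp (val a R A) < 2 ^ w\<close>
    by (intro exI[of _ "R1(d := inp (val a R A))"] conjI) (simp_all only: expr_cost.simps, auto)
next
  case (Cell c a b)
  from Cell.prems Cell.IH(1)[of R' d] obtain R1 where R1:
    "exec w (compile_expr a d) (R', M) (expr_cost a) (R1, M)"
    "R1 d = val a R A" "val a R A < 2 ^ w" "\<forall>r<d. R1 r = R' r" by auto
  have "represents (R1, M) R A" using Cell.prems(1,3) R1(4) by (auto simp: represents_def)
  with Cell.prems Cell.IH(2)[of R1 "Suc d"] obtain R2 where R2:
    "exec w (compile_expr b (Suc d)) (R1, M) (expr_cost b) (R2, M)"
    "R2 (Suc d) = val b R A" "val b R A < 2 ^ w" "\<forall>r<Suc d. R2 r = R1 r" by auto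
  define i j where "i = val a R A" and "j = val b R A"
  have ij: "i < Z" "j < D" "c < 16" using Cell.prems by (auto simp: i_def j_def)
  have "R2 60 = B" "R2 61 = D" using Cell.prems(1,3) R1(4) R2(4) by (auto simp: represents_def)
  then obtain R3 where R3: "exec w (address c d) (R2, M) 7 (R3, M)"
    "R3 d = loc c i j" "\<forall>r<d. R3 r = R2 r"
    using exec_address[of R2 d i j c M] Cell.prems(3) ij R1 R2 by (auto simp: i_def j_def)
  have m: "M (R3 d) = A c i j" "A c i j < 2 ^ w"
    using Cell.prems(1) ij R3(2) by (auto simp: represents_def)
  then have "exec w (Load d d) (R3, M) 1 (R3(d := A c i j), M)"
    using exec.Load[of M R3 d w d] by simp
  with R1 R2 R3 have "exec w (compile_expr (Cell c a b) d) (R', M)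
      (expr_cost a + (expr_cost b + (7 + 1))) (R3(d := A c i j), M)"
    unfolding compile_expr.simps by (intro exec.Seq)
  moreover have "expr_cost (Cell c a b) = expr_cost a + (expr_cost b + (7 + 1))" by simp
  ultimately show ?case using R1 R2 R3 m
    by (intro exI[of _ "R3(d := A c i j)"] conjI) (simp_all only:, auto simp: i_def j_def)
qed

text \<open>Total correctness: a halting run is asserted to exist. Its exact length is added to the
  clock of the final state, so a running time bound is an ordinary postcondition.\<close>

definition hl :: "com \<Rightarrow> timed_state \<Rightarrow> (timed_state \<Rightarrow> bool) \<Rightarrow> bool" where
  "hl P st Q \<longleftrightarrow> (case st of (t, R, A) \<Rightarrow> \<forall>\<sigma>. represents \<sigma> R A \<longrightarrow>
     (\<exists>T \<sigma>' R' A'. exec w (compile P) \<sigma> T \<sigma>' \<and> represents \<sigma>' R' A' \<and> Q (t + T, R', A')))"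

lemma hlE:
  assumes "hl P (t, R, A) Q" "represents \<sigma> R A"
  obtains T \<sigma>' R' A' where "exec w (compile P) \<sigma> T \<sigma>'" "represents \<sigma>' R' A'" "Q (t + T, R', A')"
  using assms unfolding hl_def prod.case by blast

lemma hl_mono: "hl P st Q \<Longrightarrow> (\<And>st. Q st \<Longrightarrow> Q' st) \<Longrightarrow> hl P st Q'"
  by (cases st) (fastforce simp: hl_def)

lemma represents_regs:
  "represents (R', M) R A \<Longrightarrow> \<forall>r<64. R'' r = R' r \<Longrightarrow> represents (R'', M) R A"
  by (auto simp: represents_def)

lemma hl_Nop: "Q (t + 1, R, A) \<Longrightarrow> hl Nop (t, R, A) Q"
  unfolding hl_def by (auto intro!: exI exec.Skip)

lemma hl_Assign:
  assumes "x < 60" "ok e R A" "Q (t + expr_cost e + 1, R(x := val e R A), A)"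
  shows "hl (x ::= e) (t, R, A) Q"
  unfolding hl_def
proof (clarsimp)
  fix R' M assume rep: "represents (R', M) R A"
  then obtain R1 where R1: "exec w (compile_expr e 64) (R', M) (expr_cost e) (R1, M)"
    "R1 64 = val e R A" "val e R A < 2 ^ w" "\<forall>r<64. R1 r = R' r"
    using exec_expr[of R' M R A e 64] assms by auto
  have rep1: "represents (R1, M) R A" using rep R1(4) by (rule represents_regs)
  then have "R1 62 = 0" by (simp add: represents_def)
  then have "exec w (Op Add x 64 62) (R1, M) 1 (R1(x := val e R A), M)"
    using exec.Op[of Add R1 64 62 w x M] R1 by simp
  with R1(1) have "exec w (Seq (compile_expr e 64) (Op Add x 64 62)) (R', M)
    (expr_cost e + 1) (R1(x := val e R A), M)" by (rule exec.Seq)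
  moreover have "represents (R1(x := val e R A), M) (R(x := val e R A)) A"
    using rep1 R1(3) assms(1) by (auto simp: represents_def)
  ultimately show "\<exists>T a b. exec w (Seq (compile_expr e 64) (Op Add x 64 62)) (R', M) T (a, b) \<and>
     (\<exists>R' A'. represents (a, b) R' A' \<and> Q (t + T, R', A'))"
    using assms(3) by (metis add.assoc)
qed

lemma hl_Put:
  assumes "ok (Cell c a b) R A" "ok e R A"
    "Q (t + expr_cost a + expr_cost b + expr_cost e + 8, R, upd A c (val a R A) (val b R A) (val e R A))"
  shows "hl (Put c a b e) (t, R, A) Q"
  unfolding hl_def
proof (clarsimp simp del: address.simps)
  fix R' M assume rep: "represents (R', M) R A"
  then obtain R1 where R1: "exec w (compile_expr a 64) (R', M) (expr_cost a) (R1, M)"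
    "R1 64 = val a R A" "\<forall>r<64. R1 r = R' r"
    using exec_expr[of R' M R A a 64] assms by auto
  have rep1: "represents (R1, M) R A" using rep R1(3) by (rule represents_regs)
  then obtain R2 where R2: "exec w (compile_expr b 65) (R1, M) (expr_cost b) (R2, M)"
    "R2 65 = val b R A" "\<forall>r<65. R2 r = R1 r"
    using exec_expr[of R1 M R A b 65] assms by auto
  have rep2: "represents (R2, M) R A" using rep1 by (rule represents_regs) (use R2 in auto)
  define i j x where "i = val a R A" and "j = val b R A" and "x = val e R A"
  have ij: "i < Z" "j < D" "c < 16" using assms(1) by (auto simp: i_def j_def)
  have "R2 60 = B" "R2 61 = D" using rep2 by (auto simp: represents_def)
  then obtain R3 where R3: "exec w (address c 64) (R2, M) 7 (R3, M)"
    "R3 64 = loc c i j" "\<forall>r<64. R3 r = R2 r"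
    using exec_address[of R2 64 i j c M] ij R1 R2 by (auto simp: i_def j_def)
  have rep3: "represents (R3, M) R A" using rep2 R3(3) by (rule represents_regs)
  then obtain R4 where R4: "exec w (compile_expr e 65) (R3, M) (expr_cost e) (R4, M)"
    "R4 65 = x" "x < 2 ^ w" "\<forall>r<65. R4 r = R3 r"
    using exec_expr[of R3 M R A e 65] assms by (auto simp: x_def)
  have rep4: "represents (R4, M) R A" using rep3 by (rule represents_regs) (use R4 in auto)
  have "exec w (Store 64 65) (R4, M) 1 (R4, M(loc c i j := x))"
    using exec.Store[of w 64 65 R4 M] R3 R4 by simp
  with R1 R2 R3 R4 have ex: "exec w (Seq (compile_expr a 64) (Seq (compile_expr b 65)
      (Seq (address c 64) (Seq (compile_expr e 65) (Store 64 65))))) (R', M)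
      (expr_cost a + (expr_cost b + (7 + (expr_cost e + 1)))) (R4, M(loc c i j := x))"
    by (intro exec.Seq)
  have "represents (R4, M(loc c i j := x)) R (upd A c i j x)"
    unfolding represents_def
  proof (intro conjI allI impI)
    fix k assume "k < B"
    then show "snd (R4, M(loc c i j := x)) k = inp k"
      using rep4 loc_ge[of c i j] by (auto simp: represents_def)
  next
    fix c' i' j' assume "c' < (16::nat)" "j' < D"
    then show "snd (R4, M(loc c i j := x)) (loc c' i' j') = upd A c i j x c' i' j'"
      using rep4 ij loc_inject[of c c' j j' i i'] by (auto simp: represents_def)
  next
    fix c' i' j' assume "c' < (16::nat)" "j' < D"
    then show "upd A c i j x c' i' j' < 2 ^ w"
      using rep4 R4(3) by (auto simp: represents_def)
  qed (use rep4 in \<open>auto simp: represents_def\<close>)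
  with ex assms(3) show "\<exists>T aa ba. exec w (Seq (compile_expr a 64) (Seq (compile_expr b 65)
      (Seq (address c 64) (Seq (compile_expr e 65) (Store 64 65))))) (R', M) T (aa, ba) \<and>
     (\<exists>R' A'. represents (aa, ba) R' A' \<and> Q (t + T, R', A'))"
    by (intro exI conjI) (assumption, assumption, simp add: i_def j_def x_def ac_simps)
qed

lemma hl_Then: "hl P st (\<lambda>st'. hl P' st' Q) \<Longrightarrow> hl (P ;; P') st Q"
  unfolding hl_def by (cases st) (fastforce intro: exec.Seq simp: add.assoc)

lemma hl_IfC:
  assumes "ok e R A"
    "val e R A \<noteq> 0 \<Longrightarrow> hl P (t + expr_cost e + 1, R, A) Q"
    "val e R A = 0 \<Longrightarrow> hl P' (t + expr_cost e + 1, R, A) Q"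
  shows "hl (IF e THEN P ELSE P') (t, R, A) Q"
  unfolding hl_def
proof (clarsimp)
  fix R' M assume rep: "represents (R', M) R A"
  then obtain R1 where R1: "exec w (compile_expr e 64) (R', M) (expr_cost e) (R1, M)"
    "R1 64 = val e R A" "\<forall>r<64. R1 r = R' r"
    using exec_expr[of R' M R A e 64] assms by auto
  have rep1: "represents (R1, M) R A" using rep R1(3) by (rule represents_regs)
  obtain T \<sigma>' R'' A'' where "exec w (Cond 64 (compile P) (compile P')) (R1, M) (1 + T) \<sigma>'"
    "represents \<sigma>' R'' A''" "Q (t + expr_cost e + 1 + T, R'', A'')"
  proof (cases "val e R A = 0")
    case True
    from hlE[OF assms(3)[OF True] rep1] obtain T \<sigma>' R' A' where
      "exec w (compile P') (R1, M) T \<sigma>'" "represents \<sigma>' R' A'" "Q (t + expr_cost e + 1 + T, R', A')" .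
    with True R1(2) show ?thesis by (intro that exec.CondFalse) auto
  next
    case False
    from hlE[OF assms(2)[OF False] rep1] obtain T \<sigma>' R' A' where
      "exec w (compile P) (R1, M) T \<sigma>'" "represents \<sigma>' R' A'" "Q (t + expr_cost e + 1 + T, R', A')" .
    with False R1(2) show ?thesis by (intro that exec.CondTrue) auto
  qed
  note out = this
  have "exec w (Seq (compile_expr e 64) (Cond 64 (compile P) (compile P'))) (R', M)
      (expr_cost e + (1 + T)) \<sigma>'"
    using R1(1) out(1) by (rule exec.Seq)
  moreover have "Q (t + (expr_cost e + (1 + T)), R'', A'')" using out(3) by (simp add: add.assoc)
  ultimately show "\<exists>T a b. exec w (Seq (compile_expr e 64) (Cond 64 (compile P) (compile P'))) (R', M) T (a, b) \<and>
     (\<exists>R' A'. represents (a, b) R' A' \<and> Q (t + T, R', A'))"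
    using out(2) by (cases \<sigma>') blast
qed

text \<open>The invariant holds just before each evaluation of the guard. The measure serves
  termination alone; running time is bounded by what \<open>I\<close> says about the clock.\<close>

lemma hl_While:
  fixes m :: "timed_state \<Rightarrow> nat"
  assumes I: "I (t, R, A)"
    and guard: "\<And>t R A. I (t, R, A) \<Longrightarrow> ok e R A"
    and body: "\<And>t R A. I (t, R, A) \<Longrightarrow> val e R A \<noteq> 0 \<Longrightarrow>
      hl P (t + expr_cost e + 1, R, A) (\<lambda>st. I st \<and> m st < m (t, R, A))"
    and exit: "\<And>t R A. I (t, R, A) \<Longrightarrow> val e R A = 0 \<Longrightarrow> Q (t + expr_cost e + 1, R, A)"
  shows "hl (WHILE e DO P) (t, R, A) Q"
proof -
  let ?L = "Loop 64 (Seq (compile P) (compile_expr e 64))"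
  have loop: "I (t, R, A) \<Longrightarrow> represents (R1, M) R A \<Longrightarrow> R1 64 = val e R A \<Longrightarrow>
     \<exists>T \<sigma>' R' A'. exec w ?L (R1, M) T \<sigma>' \<and> represents \<sigma>' R' A' \<and> Q (t + expr_cost e + T, R', A')"
    for t R A R1 M
  proof (induction "m (t, R, A)" arbitrary: t R A R1 M rule: less_induct)
    case less
    show ?case
    proof (cases "val e R A = 0")
      case True
      then have "exec w ?L (R1, M) 1 (R1, M)" using less.prems by (intro exec.LoopFalse) simp
      with exit[OF less.prems(1) True] less.prems show ?thesis by (meson add.assoc)
    next
      case False
      from body[OF less.prems(1) False] less.prems(2) obtain T1 \<sigma>1 R2 A2 where 1:
        "exec w (compile P) (R1, M) T1 \<sigma>1" "represents \<sigma>1 R2 A2"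
        "I (t + expr_cost e + 1 + T1, R2, A2)" "m (t + expr_cost e + 1 + T1, R2, A2) < m (t, R, A)"
        by (rule hlE) auto
      obtain R3 M3 where s: "\<sigma>1 = (R3, M3)" by (cases \<sigma>1)
      from 1 s guard exec_expr[of R3 M3 R2 A2 e 64] obtain R4 where 2:
        "exec w (compile_expr e 64) (R3, M3) (expr_cost e) (R4, M3)"
        "R4 64 = val e R2 A2" "\<forall>r<64. R4 r = R3 r" by auto
      have "represents (R4, M3) R2 A2" using 1(2) 2(3) unfolding s by (rule represents_regs)
      from less.hyps[OF 1(4) 1(3) this 2(2)] obtain T2 \<sigma>' R' A' where 3:
        "exec w ?L (R4, M3) T2 \<sigma>'" "represents \<sigma>' R' A'"
        "Q (t + expr_cost e + 1 + T1 + expr_cost e + T2, R', A')" by auto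
      have "exec w (Seq (compile P) (compile_expr e 64)) (R1, M) (T1 + expr_cost e) (R4, M3)"
        using 1(1) 2(1) unfolding s by (rule exec.Seq)
      then have "exec w ?L (R1, M) (1 + (T1 + expr_cost e) + T2) \<sigma>'"
        using 3(1) False less.prems(3) by (intro exec.LoopTrue) auto
      with 3 show ?thesis
        by (intro exI conjI) (assumption, assumption, simp add: ac_simps)
    qed
  qed
  show ?thesis unfolding hl_def
  proof (clarsimp)
    fix R' M assume rep: "represents (R', M) R A"
    then obtain R1 where R1: "exec w (compile_expr e 64) (R', M) (expr_cost e) (R1, M)"
      "R1 64 = val e R A" "\<forall>r<64. R1 r = R' r"
      using exec_expr[of R' M R A e 64] guard[OF I] by auto
    have rep1: "represents (R1, M) R A" using rep R1(3) by (rule represents_regs)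
    from loop[OF I rep1 R1(2)] obtain T \<sigma>' R'' A'' where
      "exec w ?L (R1, M) T \<sigma>'" "represents \<sigma>' R'' A''" "Q (t + expr_cost e + T, R'', A'')" by blast
    note out = this
    have "exec w (Seq (compile_expr e 64) ?L) (R', M) (expr_cost e + T) \<sigma>'"
      using R1(1) out(1) by (rule exec.Seq)
    moreover have "Q (t + (expr_cost e + T), R'', A'')" using out(3) by (simp add: add.assoc)
    ultimately show "\<exists>T a b. exec w (Seq (compile_expr e 64) ?L) (R', M) T (a, b) \<and>
       (\<exists>R' A'. represents (a, b) R' A' \<and> Q (t + T, R', A'))"
      using out(2) by (cases \<sigma>') blast
  qed
qed

text \<open>Straight-line code and branches are computed through, while a loop keeps the semantic
  \<open>hl\<close>: symbolic execution stops there and \<open>wp_While\<close> supplies the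
  invariant.\<close>

primrec wp :: "com \<Rightarrow> timed_state \<Rightarrow> (timed_state \<Rightarrow> bool) \<Rightarrow> bool" where
  "wp Nop st Q \<longleftrightarrow> (case st of (t, R, A) \<Rightarrow> Q (t + 1, R, A))"
| "wp (x ::= e) st Q \<longleftrightarrow> (case st of (t, R, A) \<Rightarrow>
     x < 60 \<and> ok e R A \<and> Q (t + expr_cost e + 1, R(x := val e R A), A))"
| "wp (Put c a b e) st Q \<longleftrightarrow> (case st of (t, R, A) \<Rightarrow>
     ok (Cell c a b) R A \<and> ok e R A \<and>
     Q (t + expr_cost a + expr_cost b + expr_cost e + 8, R,
        upd A c (val a R A) (val b R A) (val e R A)))"
| "wp (P ;; P') st Q \<longleftrightarrow> wp P st (\<lambda>st'. wp P' st' Q)"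
| "wp (IF e THEN P ELSE P') st Q \<longleftrightarrow> (case st of (t, R, A) \<Rightarrow>
     ok e R A \<and>
     (if val e R A \<noteq> 0 then wp P (t + expr_cost e + 1, R, A) Q
      else wp P' (t + expr_cost e + 1, R, A) Q))"
| "wp (WHILE e DO P) st Q \<longleftrightarrow> hl (WHILE e DO P) st Q"

lemma wp_mono: "wp P st Q \<Longrightarrow> (\<And>st. Q st \<Longrightarrow> Q' st) \<Longrightarrow> wp P st Q'"
proof (induction P arbitrary: st Q Q')
  case (Then P1 P2)
  from Then.prems(1) have "wp P1 st (\<lambda>st'. wp P2 st' Q)" by simp
  then have "wp P1 st (\<lambda>st'. wp P2 st' Q')"
    by (rule Then.IH(1)) (erule Then.IH(2), rule Then.prems(2))
  then show ?case by simp
next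
  case (IfC e P1 P2)
  from IfC.prems(1) show ?case
    by (cases st) (auto split: if_splits intro: IfC.IH IfC.prems(2))
qed (auto split: prod.splits intro: hl_mono)

text \<open>
  As a congruence rule, this makes the simplifier execute programs forward, instead of first
  expanding the continuation for a symbolic state.
\<close>

lemma wp_cong: "st = st' \<Longrightarrow> wp P st Q = wp P st' Q"
  by simp

lemma wp_sound: "wp P st Q \<Longrightarrow> hl P st Q"
proof (induction P arbitrary: st Q)
  case (Then P1 P2)
  from Then.prems have "wp P1 st (\<lambda>st'. wp P2 st' Q)" by simp
  then have "wp P1 st (\<lambda>st'. hl P2 st' Q)" by (rule wp_mono) (rule Then.IH(2))
  then show ?case by (intro hl_Then Then.IH(1))
next
  case (Assign x e)
  then show ?case by (cases st) (auto intro: hl_Assign)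
next
  case (Put c a b e)
  then show ?case by (cases st) (auto intro!: hl_Put)
next
  case (IfC e P1 P2)
  from IfC.prems show ?case
    by (cases st) (auto split: if_splits intro!: hl_IfC IfC.IH)
qed (auto split: prod.splits intro: hl_Nop)

lemma wp_While:
  fixes m :: "timed_state \<Rightarrow> nat"
  assumes "I (t, R, A)"
    and "\<And>t R A. I (t, R, A) \<Longrightarrow> ok e R A"
    and "\<And>t R A. I (t, R, A) \<Longrightarrow> val e R A \<noteq> 0 \<Longrightarrow>
      wp P (t + expr_cost e + 1, R, A) (\<lambda>st. I st \<and> m st < m (t, R, A))"
    and "\<And>t R A. I (t, R, A) \<Longrightarrow> val e R A = 0 \<Longrightarrow> Q (t + expr_cost e + 1, R, A)"
  shows "wp (WHILE e DO P) (t, R, A) Q"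
  unfolding wp.simps
proof (rule hl_While[of I t R A e P m Q])
  fix t R A assume "I (t, R, A)" "val e R A \<noteq> 0"
  then show "hl P (t + expr_cost e + 1, R, A) (\<lambda>st. I st \<and> m st < m (t, R, A))"
    by (rule wp_sound[OF assms(3)])
qed (fact assms)+

declare wp.simps(6) [simp del]

end

section \<open>Paths and the table recurrence\<close>

lemma temporal_path_snoc:
  "temporal_path E s u (p @ [e]) \<longleftrightarrow> e \<in> E \<and> temporal_path E s (tail e) p \<and> head e = u \<and>
     (p \<noteq> [] \<longrightarrow> arrival (last p) \<le> appearance e) \<and> u \<notin> set (s # map head p)"
proof -
  have l: "last (s # map head p) = (s # map head p) ! length p"
    by (simp add: last_conv_nth nth_Cons')
  have nth: "(s # map head p @ [head e]) ! i = (s # map head p) ! i" if "i \<le> length p" for i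
    using that nth_append[of "s # map head p" "[head e]" i] by simp
  have "(\<forall>i<length (p @ [e]). tail ((p @ [e]) ! i) = (s # map head (p @ [e])) ! i) \<longleftrightarrow>
      (\<forall>i<length p. tail (p ! i) = (s # map head p) ! i) \<and> last (s # map head p) = tail e"
    unfolding l by (auto simp: less_Suc_eq nth nth_append)
  moreover have "(\<forall>i. Suc i < length (p @ [e]) \<longrightarrow>
        arrival ((p @ [e]) ! i) \<le> appearance ((p @ [e]) ! Suc i)) \<longleftrightarrow>
      (\<forall>i. Suc i < length p \<longrightarrow> arrival (p ! i) \<le> appearance (p ! Suc i)) \<and>
      (p \<noteq> [] \<longrightarrow> arrival (last p) \<le> appearance e)"
    by (cases p rule: rev_cases) (auto simp: less_Suc_eq nth_append)
  ultimately show ?thesis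
    unfolding temporal_path_def by auto
qed

lemma restless_snoc:
  "restless \<Delta> (p @ [e]) \<longleftrightarrow>
     restless \<Delta> p \<and> (p \<noteq> [] \<longrightarrow> appearance e - arrival (last p) \<le> \<Delta>)"
  unfolding restless_def by (cases p rule: rev_cases) (auto simp: less_Suc_eq nth_append)

section \<open>Sets of colours as binary numbers\<close>

lemma set_encode_less: "A \<subseteq> {..<n} \<Longrightarrow> set_encode A < 2 ^ n"
proof -
  assume "A \<subseteq> {..<n}"
  then have "set_encode A \<le> set_encode {..<n}"
    unfolding set_encode_def by (intro sum_mono2) auto
  also have "\<dots> < 2 ^ n" by (induction n) (auto simp: set_encode_def lessThan_Suc)
  finally show ?thesis .
qed

lemma set_decode_less: "S < 2 ^ n \<Longrightarrow> set_decode S \<subseteq> {..<n}"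
proof
  fix b assume S: "S < 2 ^ n" and "b \<in> set_decode S"
  then have "S div 2 ^ b \<noteq> 0" by (metis set_decode_def mem_Collect_eq even_zero)
  then have "2 ^ b \<le> S" by (metis div_less not_less)
  with S have "(2::nat) ^ b < 2 ^ n" by linarith
  then show "b \<in> {..<n}" by simp
qed

text \<open>Adding an absent bit causes no carry, so the machine inserts a colour by a single
  addition.\<close>

lemma plus_power_eq_set_encode:
  "b \<notin> set_decode S \<Longrightarrow> S + 2 ^ b = set_encode (insert b (set_decode S))"
  by simp

locale arc_sequence =
  fixes es :: "'v tarc list" and s :: 'v and \<Delta> :: nat
  assumes delay_pos: "i < length es \<Longrightarrow> 0 < delay (es ! i)"
    and sorted_es: "sorted (map appearance es)"
begin

abbreviation "n \<equiv> length es"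

definition src where "src i = tail (es ! i)"
definition dst where "dst i = head (es ! i)"
definition dep where "dep i = appearance (es ! i)"
definition arr where "arr i = arrival (es ! i)"

lemma dep_mono: "i \<le> j \<Longrightarrow> j < n \<Longrightarrow> dep i \<le> dep j"
  using sorted_es by (auto simp: dep_def sorted_iff_nth_mono)

lemma dep_less_arr: "i < n \<Longrightarrow> dep i < arr i"
  using delay_pos[of i] by (simp add: dep_def arr_def arrival_def)

text \<open>Positive delays make one pass in listing order sufficient: every arc that can precede
  \<open>j\<close> on a path departs strictly earlier, so ties in the order of the arcs are
  harmless.\<close>

lemma index_less: "i < n \<Longrightarrow> arr i \<le> dep j \<Longrightarrow> i < j"
  using dep_mono[of j i] dep_less_arr[of i] by linarith

text \<open>\<open>reach j U\<close>: some \<open>\<Delta>\<close>-restless temporal path from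
  \<open>s\<close> ends with arc \<open>j\<close> and visits exactly the nodes in \<open>U\<close>.
  The first arc has no waiting condition.\<close>

inductive reach :: "nat \<Rightarrow> 'v set \<Rightarrow> bool" where
  start: "j < n \<Longrightarrow> src j = s \<Longrightarrow> dst j \<noteq> s \<Longrightarrow> reach j {dst j, s}"
| step: "reach i U \<Longrightarrow> j < n \<Longrightarrow> src j = dst i \<Longrightarrow> arr i \<le> dep j \<Longrightarrow> dep j \<le> arr i + \<Delta> \<Longrightarrow>
    dst j \<notin> U \<Longrightarrow> reach j (insert (dst j) U)"

lemma reach_path:
  "reach j U \<Longrightarrow> j < n \<and> (\<exists>p. temporal_path (set es) s (dst j) p \<and> restless \<Delta> p \<and> p \<noteq> [] \<and>
     last p = es ! j \<and> set (s # map head p) = U)"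
proof (induction rule: reach.induct)
  case (start j)
  then show ?case
    using temporal_path_snoc[of "set es" s "dst j" "[]" "es ! j"] restless_snoc[of \<Delta> "[]" "es ! j"]
    by (intro conjI exI[of _ "[es ! j]"])
      (auto simp: src_def dst_def temporal_path_def restless_def)
next
  case (step i U j)
  then obtain p where p: "temporal_path (set es) s (dst i) p" "restless \<Delta> p" "p \<noteq> []"
    "last p = es ! i" "set (s # map head p) = U" by blast
  with step show ?case
    by (intro conjI exI[of _ "p @ [es ! j]"])
      (auto simp: temporal_path_snoc restless_snoc src_def dst_def dep_def arr_def)
qed

lemma path_reach:
  "temporal_path (set es) s u p \<Longrightarrow> restless \<Delta> p \<Longrightarrow> p \<noteq> [] \<Longrightarrow>
     \<exists>j<n. last p = es ! j \<and> dst j = u \<and> reach j (set (s # map head p))"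
proof (induction p arbitrary: u rule: rev_induct)
  case (snoc e p)
  from snoc.prems have e: "e \<in> set es" "temporal_path (set es) s (tail e) p" "head e = u"
    "p \<noteq> [] \<longrightarrow> arrival (last p) \<le> appearance e" "u \<notin> set (s # map head p)"
    "restless \<Delta> p" "p \<noteq> [] \<longrightarrow> appearance e - arrival (last p) \<le> \<Delta>"
    unfolding temporal_path_snoc restless_snoc by auto
  then obtain j where j: "j < n" "es ! j = e" by (auto simp: in_set_conv_nth)
  show ?case
  proof (cases "p = []")
    case True
    then have "reach j {dst j, s}"
      using e j by (intro reach.start) (auto simp: src_def dst_def temporal_path_def)
    with True e j show ?thesis by (intro exI[of _ j]) (auto simp: dst_def insert_commute)
  next
    case False
    with snoc.IH[OF e(2,6)] obtain i where i: "i < n" "last p = es ! i" "dst i = tail e"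
      "reach i (set (s # map head p))" by blast
    have "reach j (insert (dst j) (set (s # map head p)))"
      using e j i False by (intro reach.step[OF i(4)]) (auto simp: src_def dst_def dep_def arr_def)
    with e j show ?thesis by (intro exI[of _ j]) (auto simp: dst_def insert_commute)
  qed
qed simp

lemma restless_path_iff:
  "(\<exists>p. temporal_path (set es) s t p \<and> restless \<Delta> p) \<longleftrightarrow> s = t \<or> (\<exists>j<n. \<exists>U. reach j U \<and> dst j = t)"
proof
  assume "\<exists>p. temporal_path (set es) s t p \<and> restless \<Delta> p"
  then obtain p where "temporal_path (set es) s t p" "restless \<Delta> p" by blast
  then show "s = t \<or> (\<exists>j<n. \<exists>U. reach j U \<and> dst j = t)"
    using path_reach[of t p] by (cases "p = []") (auto simp: temporal_path_def)
next
  assume "s = t \<or> (\<exists>j<n. \<exists>U. reach j U \<and> dst j = t)"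
  then show "\<exists>p. temporal_path (set es) s t p \<and> restless \<Delta> p"
  proof
    assume "s = t"
    then have "temporal_path (set es) s t [] \<and> restless \<Delta> []"
      by (simp add: temporal_path_def restless_def)
    then show ?thesis ..
  qed (use reach_path in blast)
qed

text \<open>
  Positions in the listing take the role of time: \<open>live j\<close> is contained in the set \<open>F\<^sub>\<tau>\<close> of the
  appearance time \<open>\<tau>\<close> of arc \<open>j\<close>.
\<close>

definition before :: "nat \<Rightarrow> 'v \<Rightarrow> bool" where
  "before j x \<longleftrightarrow> (\<exists>i<n. i \<le> j \<and> endpoint x (es ! i))"

definition after :: "nat \<Rightarrow> 'v \<Rightarrow> bool" where
  "after j x \<longleftrightarrow> (\<exists>i<n. j \<le> i \<and> endpoint x (es ! i))"

definition live :: "nat \<Rightarrow> 'v set" where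
  "live j = {x. before j x \<and> after j x}"

lemma endpoint_src [simp]: "endpoint (src j) (es ! j)" and endpoint_dst [simp]: "endpoint (dst j) (es ! j)"
  by (simp_all add: endpoint_def src_def dst_def)

lemma endpoint_live: "j < n \<Longrightarrow> endpoint x (es ! j) \<Longrightarrow> x \<in> live j"
  by (auto simp: live_def before_def after_def)

lemma before_mono: "before i x \<Longrightarrow> i \<le> j \<Longrightarrow> before j x"
  by (auto simp: before_def)

lemma after_mono: "after j x \<Longrightarrow> i \<le> j \<Longrightarrow> after i x"
  by (auto simp: after_def)

lemma reach_less: "reach j U \<Longrightarrow> j < n"
  using reach_path by blast

lemma reach_before: "reach j U \<Longrightarrow> x \<in> U \<Longrightarrow> before j x"
proof (induction rule: reach.induct)
  case (start j)
  then show ?case using endpoint_src[of j] endpoint_dst[of j] by (auto simp: before_def)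
next
  case (step i U j)
  show ?case
  proof (cases "x = dst j")
    case True
    then show ?thesis using step endpoint_dst[of j] by (auto simp: before_def)
  next
    case False
    then have "before i x" using step by auto
    moreover have "i < j" using step reach_less index_less by blast
    ultimately show ?thesis using before_mono by force
  qed
qed

lemma reach_source: "reach j U \<Longrightarrow> s \<in> U \<and> dst j \<noteq> s \<and> dst j \<in> U"
  by (induction rule: reach.induct) auto

lemma finite_live: "finite (live j)"
proof -
  have "live j \<subseteq> (\<Union>i\<in>{..<n}. {src i, dst i})"
    by (auto simp: live_def before_def endpoint_def src_def dst_def)
  then show ?thesis by (rule finite_subset) auto
qed

end

section \<open>The table recurrence over coloured sets\<close>

locale coloured_sequence = arc_sequence +
  fixes f :: "'a \<Rightarrow> nat" and K :: nat
  assumes inj_colour: "inj_on f (live j)"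
    and colour_less: "x \<in> live j \<Longrightarrow> f x < K"
begin

definition code :: "nat \<Rightarrow> 'a set \<Rightarrow> nat" where
  "code j U = set_encode (f ` (U \<inter> live j))"

text \<open>\<open>lst b\<close> is the last position, plus one, of the node that currently holds
  colour \<open>b\<close>; the strict comparison keeps the colours whose node still has an arc from
  \<open>q\<close> on.\<close>

definition proj :: "(nat \<Rightarrow> nat) \<Rightarrow> nat \<Rightarrow> nat \<Rightarrow> nat" where
  "proj lst S q = set_encode {b \<in> set_decode S. q < lst b}"

lemma set_decode_code: "set_decode (code j U) = f ` (U \<inter> live j)"
  by (simp add: code_def finite_live)

lemma code_less: "code j U < 2 ^ K"
  unfolding code_def by (rule set_encode_less) (auto simp: colour_less)

lemma mem_code_iff: "x \<in> live j \<Longrightarrow> f x \<in> set_decode (code j U) \<longleftrightarrow> x \<in> U"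
  using inj_colour[of j] by (auto simp: set_decode_code inj_on_def)

lemma code_insert:
  assumes "x \<in> live j" "x \<notin> U"
  shows "code j (insert x U) = code j U + 2 ^ f x"
proof -
  have "f x \<notin> set_decode (code j U)" using assms mem_code_iff by blast
  then have "code j U + 2 ^ f x = set_encode (insert (f x) (f ` (U \<inter> live j)))"
    by (simp add: plus_power_eq_set_encode set_decode_code del: set_encode_insert)
  then show ?thesis using assms(1) by (simp add: code_def)
qed

text \<open>Between \<open>j\<close> and \<open>q\<close> a set can only lose colours: all visited
  nodes already occur up to \<open>j\<close>, so one that is live at \<open>q\<close> was live at
  \<open>j\<close>.\<close>

lemma proj_code:
  assumes lst: "\<And>x. x \<in> live j \<Longrightarrow> q < lst (f x) \<longleftrightarrow> after q x"
    and "j \<le> q" "\<And>x. x \<in> U \<Longrightarrow> before j x"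
  shows "proj lst (code j U) q = code q U"
proof -
  have "{b \<in> set_decode (code j U). q < lst b} = f ` (U \<inter> live q)"
    using assms after_mono[of q _ j] before_mono[of j _ q]
    unfolding set_decode_code by (force simp: live_def)
  then show ?thesis by (simp add: proj_def code_def)
qed

text \<open>An entry of the table is \<open>0\<close> or an arrival time plus one.\<close>

definition sound :: "nat \<Rightarrow> (nat \<Rightarrow> nat \<Rightarrow> nat) \<Rightarrow> bool" where
  "sound j T \<longleftrightarrow> (\<forall>S q. j \<le> q \<longrightarrow> q < n \<longrightarrow> T S q \<noteq> 0 \<longrightarrow> (\<exists>U. S = code q U \<and> T S q \<le> dep q + 1 \<and>
     (src q = s \<and> U = {s} \<or> (\<exists>i<j. reach i U \<and> dst i = src q \<and> T S q = arr i + 1))))"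

text \<open>
  A partial path ending with arc \<open>i\<close> is only recorded at the first arc from position \<open>j\<close> on that
  leaves its end node after its arrival.
\<close>

definition complete :: "nat \<Rightarrow> (nat \<Rightarrow> nat \<Rightarrow> nat) \<Rightarrow> bool" where
  "complete j T \<longleftrightarrow> (\<forall>i U q. i < j \<longrightarrow> reach i U \<longrightarrow> j \<le> q \<longrightarrow> q < n \<longrightarrow> src q = dst i \<longrightarrow>
     arr i \<le> dep q \<longrightarrow> (\<forall>q'. j \<le> q' \<longrightarrow> q' < q \<longrightarrow> src q' = dst i \<longrightarrow> dep q' < arr i) \<longrightarrow>
     arr i < T (code q U) q)"

text \<open>
  For an entry \<open>a + 1\<close>, the condition \<open>dep j - \<Delta> < a + 1\<close> means \<open>dep j \<le> a + \<Delta>\<close>, also when the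
  subtraction is truncated.
\<close>

definition extendable :: "nat \<Rightarrow> (nat \<Rightarrow> nat \<Rightarrow> nat) \<Rightarrow> nat \<Rightarrow> bool" where
  "extendable j T S \<longleftrightarrow> T S j \<noteq> 0 \<and> dep j - \<Delta> < T S j \<and> f (dst j) \<notin> set_decode S"

text \<open>The empty path is always in time for an arc that leaves the source.\<close>

definition with_source :: "nat \<Rightarrow> (nat \<Rightarrow> nat \<Rightarrow> nat) \<Rightarrow> nat \<Rightarrow> nat \<Rightarrow> nat" where
  "with_source j T = (if src j = s then T(2 ^ f s := (T (2 ^ f s))(j := dep j + 1)) else T)"

definition is_first :: "(nat \<Rightarrow> bool) \<Rightarrow> nat \<Rightarrow> bool" where
  "is_first P q \<longleftrightarrow> q \<le> n \<and> (q < n \<longrightarrow> P q) \<and> (\<forall>i<q. \<not> P i)"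

text \<open>The entries at position \<open>n\<close> are never read; this position stands for "no such arc".\<close>

definition table_step ::
  "nat \<Rightarrow> (nat \<Rightarrow> nat) \<Rightarrow> nat \<Rightarrow> nat \<Rightarrow> (nat \<Rightarrow> nat \<Rightarrow> nat) \<Rightarrow> nat \<Rightarrow> (nat \<Rightarrow> nat \<Rightarrow> nat) \<Rightarrow> bool" where
  "table_step j lst q1 q2 T m T' \<longleftrightarrow>
     (\<forall>S q. T S q \<le> T' S q) \<and>
     (\<forall>S q. T' S q \<noteq> T S q \<longrightarrow> (\<exists>S0<m. T S0 j \<noteq> 0 \<and>
        (q = q1 \<and> S = proj lst S0 q1 \<and> T' S q = T S0 j \<or>
         extendable j T S0 \<and> q = q2 \<and> S = proj lst (S0 + 2 ^ f (dst j)) q2 \<and> T' S q = arr j + 1))) \<and>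
     (\<forall>S0<m. T S0 j \<noteq> 0 \<longrightarrow> T S0 j \<le> T' (proj lst S0 q1) q1 \<and>
        (extendable j T S0 \<longrightarrow> arr j + 1 \<le> T' (proj lst (S0 + 2 ^ f (dst j)) q2) q2))"

context
  fixes j T
  assumes j: "j < n" and snd: "sound j T" and cmp: "complete j T"
begin

lemma code_source: "src j = s \<Longrightarrow> code j {s} = 2 ^ f s"
  using j endpoint_live[of j s] endpoint_src[of j] by (simp add: code_def)

lemma with_source_entry:
  assumes "with_source j T S j \<noteq> 0"
  shows "\<exists>U. S = code j U \<and> with_source j T S j \<le> dep j + 1 \<and>
     (src j = s \<and> U = {s} \<or> (\<exists>i<j. reach i U \<and> dst i = src j \<and> with_source j T S j = arr i + 1))"
proof (cases "src j = s \<and> S = 2 ^ f s")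
  case True
  then show ?thesis using code_source by (intro exI[of _ "{s}"]) (auto simp: with_source_def)
next
  case False
  then have "with_source j T S j = T S j" by (auto simp: with_source_def)
  with assms snd j show ?thesis unfolding sound_def by force
qed

text \<open>The head of \<open>j\<close> is live at \<open>j\<close>, where colours are injective,
  so the colour test decides exactly whether the head was visited. \<open>sound\<close> provides
  that the arrival is in time for \<open>j\<close>, and the comparison with
  \<open>dep j - \<Delta>\<close> bounds the wait.\<close>

lemma extendable_reach:
  assumes "extendable j (with_source j T) S"
  shows "\<exists>U. S + 2 ^ f (dst j) = code j U \<and> reach j U"
proof -
  let ?a = "with_source j T S j"
  from assms have a: "?a \<noteq> 0" "dep j - \<Delta> < ?a" "f (dst j) \<notin> set_decode S"
    by (auto simp: extendable_def)
  from with_source_entry[OF a(1)] obtain U where U: "S = code j U" "?a \<le> dep j + 1"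
    "src j = s \<and> U = {s} \<or> (\<exists>i<j. reach i U \<and> dst i = src j \<and> ?a = arr i + 1)" by blast
  have d: "dst j \<in> live j" using j endpoint_live by simp
  with a(3) U(1) have new: "dst j \<notin> U" using mem_code_iff by blast
  from U(3) have "reach j (insert (dst j) U)"
  proof
    assume "src j = s \<and> U = {s}"
    with new j show ?thesis using reach.start[of j] by auto
  next
    assume "\<exists>i<j. reach i U \<and> dst i = src j \<and> ?a = arr i + 1"
    then obtain i where i: "reach i U" "dst i = src j" "?a = arr i + 1" by blast
    with new j a(2) U(2) show ?thesis by (intro reach.step[OF i(1)]) auto
  qed
  moreover have "S + 2 ^ f (dst j) = code j (insert (dst j) U)"
    using code_insert[OF d new] U(1) by simp
  ultimately show ?thesis by blast
qed

text \<open>For the last arc \<open>j\<close> of a path, \<open>complete\<close> applies with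
  \<open>q = j\<close>, where nothing lies in between. The entry found may stem from another path
  with the same code and a later arrival; that one waits even less, so \<open>j\<close> can still be
  appended.\<close>

lemma reach_extendable:
  assumes "reach j U"
  shows "\<exists>S<2 ^ K. extendable j (with_source j T) S \<and> S + 2 ^ f (dst j) = code j U"
proof -
  have d: "dst j \<in> live j" using j endpoint_live by simp
  from assms show ?thesis
  proof cases
    case start
    have "extendable j (with_source j T) (code j {s})"
      using start code_source mem_code_iff[OF d, of "{s}"] by (auto simp: extendable_def with_source_def)
    moreover have "code j {s} + 2 ^ f (dst j) = code j U"
      using code_insert[OF d, of "{s}"] start by simp
    ultimately show ?thesis using code_less by blast
  next
    case (step i U')
    have ij: "i < j" using step reach_less index_less by blast
    have "src j \<noteq> s" using step reach_source by auto
    then have ws: "with_source j T = T" by (simp add: with_source_def)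
    have "arr i < T (code j U') j"
      using cmp[unfolded complete_def, rule_format, of i U' j] ij step j by auto
    then have "extendable j T (code j U')"
      using step mem_code_iff[OF d, of U'] by (auto simp: extendable_def)
    moreover have "code j U' + 2 ^ f (dst j) = code j U"
      using code_insert[OF d, of U'] step by simp
    ultimately show ?thesis using code_less ws by auto
  qed
qed

context
  fixes lst q1 q2 T'
  assumes lst: "\<And>x q. x \<in> live j \<Longrightarrow> q < lst (f x) \<longleftrightarrow> after q x"
    and q1: "is_first (\<lambda>q. j < q \<and> src q = src j) q1"
    and q2: "is_first (\<lambda>q. src q = dst j \<and> arr j \<le> dep q) q2"
    and step: "table_step j lst q1 q2 (with_source j T) (2 ^ K) T'"
begin

lemma q2_greater: "j < q2"
  using q2 j index_less by (cases "q2 < n") (auto simp: is_first_def)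

text \<open>A passed-on arrival stays in time because later arcs depart no earlier. The empty path
  has no arrival time: its entries are passed on as well, are bounded only by the departure, and are
  replaced by \<open>with_source\<close> when their column is reached.\<close>

lemma sound_step: "sound (Suc j) T'"
  unfolding sound_def
proof (intro allI impI)
  fix S q assume q: "Suc j \<le> q" "q < n" "T' S q \<noteq> 0"
  let ?T = "with_source j T"
  show "\<exists>U. S = code q U \<and> T' S q \<le> dep q + 1 \<and>
     (src q = s \<and> U = {s} \<or> (\<exists>i<Suc j. reach i U \<and> dst i = src q \<and> T' S q = arr i + 1))"
  proof (cases "T' S q = ?T S q")
    case True
    \<comment> \<open>\<open>with_source\<close> changes column \<open>j\<close> only, and
      \<open>q\<close> lies behind it.\<close>
    then have eq: "T' S q = T S q" using q by (auto simp: with_source_def)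
    from snd[unfolded sound_def, rule_format, of q S] q obtain U where
      "S = code q U" "T' S q \<le> dep q + 1"
      "src q = s \<and> U = {s} \<or> (\<exists>i<j. reach i U \<and> dst i = src q \<and> T' S q = arr i + 1)"
      unfolding eq using Suc_leD by blast
    then show ?thesis using less_SucI by (intro exI[of _ U]) blast
  next
    case False
    with step obtain S0 where S0: "?T S0 j \<noteq> 0" and alt:
      "q = q1 \<and> S = proj lst S0 q1 \<and> T' S q = ?T S0 j \<or>
       extendable j ?T S0 \<and> q = q2 \<and> S = proj lst (S0 + 2 ^ f (dst j)) q2 \<and> T' S q = arr j + 1"
      unfolding table_step_def by blast
    from alt show ?thesis
    proof
      assume 1: "q = q1 \<and> S = proj lst S0 q1 \<and> T' S q = ?T S0 j"
      from with_source_entry[OF S0] obtain U where U: "S0 = code j U" "?T S0 j \<le> dep j + 1"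
        "src j = s \<and> U = {s} \<or> (\<exists>i<j. reach i U \<and> dst i = src j \<and> ?T S0 j = arr i + 1)" by blast
      have bef: "before j x" if "x \<in> U" for x
        using U(3)
      proof
        assume "src j = s \<and> U = {s}"
        then show ?thesis using that j endpoint_src[of j] by (auto simp: before_def)
      next
        assume "\<exists>i<j. reach i U \<and> dst i = src j \<and> ?T S0 j = arr i + 1"
        then show ?thesis using that reach_before before_mono less_imp_le by blast
      qed
      have "S = code q U"
        using 1 U(1) proj_code[of j q lst U] lst q(1) bef by auto
      moreover have src: "src q = src j" using q1 1 q(2) by (auto simp: is_first_def)
      have "src q = s \<and> U = {s} \<or> (\<exists>i<Suc j. reach i U \<and> dst i = src q \<and> T' S q = arr i + 1)"
        using U(3) 1 unfolding src by (metis less_SucI)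
      moreover have "dep j \<le> dep q" using q by (intro dep_mono) auto
      ultimately show ?thesis using U(2) 1 by (intro exI[of _ U]) auto
    next
      assume 2: "extendable j ?T S0 \<and> q = q2 \<and> S = proj lst (S0 + 2 ^ f (dst j)) q2 \<and> T' S q = arr j + 1"
      from 2 extendable_reach obtain U where U: "S0 + 2 ^ f (dst j) = code j U" "reach j U" by blast
      have "S = code q U"
        using 2 U proj_code[of j q lst U] lst q(1) reach_before by auto
      moreover have "src q = dst j" "arr j \<le> dep q" using q2 2 q(2) by (auto simp: is_first_def)
      ultimately show ?thesis using U 2 by (intro exI[of _ U]) auto
    qed
  qed
qed

text \<open>Three kinds of paths: one ending with \<open>j\<close> is recorded at \<open>q2\<close>;
  an older one whose recorded arc was \<open>j\<close> moves on to \<open>q1\<close>; for any other,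
  the recorded arc stays the same and entries never decrease.\<close>

lemma complete_step: "complete (Suc j) T'"
  unfolding complete_def
proof (intro allI impI)
  fix i U q assume i: "i < Suc j" "reach i U" "Suc j \<le> q" "q < n" "src q = dst i" "arr i \<le> dep q"
    and min: "\<forall>q'. Suc j \<le> q' \<longrightarrow> q' < q \<longrightarrow> src q' = dst i \<longrightarrow> dep q' < arr i"
  let ?T = "with_source j T"
  have mono: "?T S q \<le> T' S q" for S q using step by (auto simp: table_step_def)
  show "arr i < T' (code q U) q"
  proof (cases "i = j")
    case True
    \<comment> \<open>Minimality of \<open>q\<close> is known from \<open>Suc j\<close> on only,
      which is enough since \<open>q2\<close> lies behind \<open>j\<close> by
      \<open>q2_greater\<close>.\<close>
    have "q2 = q"
    proof (rule linorder_cases[of q2 q])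
      assume "q2 < q"
      with q2 i have "src q2 = dst j \<and> arr j \<le> dep q2" by (auto simp: is_first_def)
      with min[rule_format, of q2] True q2_greater \<open>q2 < q\<close> show ?thesis by auto
    qed (use q2 i True in \<open>auto simp: is_first_def\<close>)
    moreover from reach_extendable i True obtain S where S: "S < 2 ^ K" "extendable j ?T S"
      "S + 2 ^ f (dst j) = code j U" by blast
    moreover from S have "arr j + 1 \<le> T' (proj lst (S + 2 ^ f (dst j)) q2) q2"
      using step by (auto simp: table_step_def extendable_def)
    moreover have "proj lst (code j U) q = code q U"
      using i True reach_before lst by (intro proj_code) auto
    ultimately show ?thesis using True by simp
  next
    case False
    then have ij: "i < j" using i by simp
    show ?thesis
    proof (cases "src j = dst i \<and> arr i \<le> dep j")
      case True
      then have "src j \<noteq> s" using i reach_source by auto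
      then have ws: "?T = T" by (simp add: with_source_def)
      \<comment> \<open>The path could already leave with \<open>j\<close>, so every later departure
        is in time too, and the first usable arc is just the next one with the same tail.\<close>
      have "q1 = q"
      proof (rule linorder_cases[of q1 q])
        assume "q1 < q"
        with q1 i have *: "j < q1 \<and> src q1 = src j" by (auto simp: is_first_def)
        then have "dep j \<le> dep q1" using \<open>q1 < q\<close> i by (intro dep_mono) auto
        with min[rule_format, of q1] True * \<open>q1 < q\<close> show ?thesis by auto
      qed (use q1 i True in \<open>auto simp: is_first_def\<close>)
      have "arr i < T (code j U) j"
        using cmp[unfolded complete_def, rule_format, of i U j] ij i(2) j True by auto
      moreover from this have "T (code j U) j \<le> T' (proj lst (code j U) q1) q1"
        using step ws code_less[of j U] by (auto simp: table_step_def)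
      moreover have bef: "before j x" if "x \<in> U" for x
        using that i(2) ij reach_before before_mono less_imp_le by blast
      then have "proj lst (code j U) q = code q U"
        using i bef lst by (intro proj_code) auto
      ultimately show ?thesis using \<open>q1 = q\<close> by simp
    next
      case False
      \<comment> \<open>Arc \<open>j\<close> is not usable for this path, so minimality from
        \<open>Suc j\<close> on extends to \<open>j\<close>.\<close>
      have "dep q' < arr i" if "j \<le> q'" "q' < q" "src q' = dst i" for q'
        using False min that by (cases "q' = j") auto
      then have "arr i < T (code q U) q"
        using cmp[unfolded complete_def, rule_format, of i U q] ij i by auto
      also have "T (code q U) q = ?T (code q U) q" using i by (auto simp: with_source_def)
      finally show ?thesis using mono[of "code q U" q] by linarith
    qed
  qed
qed

end

lemma reach_iff_extendable:
  "(\<exists>U. reach j U) \<longleftrightarrow> (\<exists>S<2 ^ K. extendable j (with_source j T) S)"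
  using extendable_reach reach_extendable by blast

end

end

section \<open>Indexing the arcs and colouring the nodes\<close>

abbreviation (input) plus_expr (infixl "\<oplus>" 65) where "a \<oplus> b \<equiv> Bin Add a b"
abbreviation (input) minus_expr (infixl "\<ominus>" 65) where "a \<ominus> b \<equiv> Bin Sub a b"
abbreviation (input) times_expr (infixl "\<otimes>" 70) where "a \<otimes> b \<equiv> Bin Mul a b"
abbreviation (input) div_expr (infixl "\<oslash>" 70) where "a \<oslash> b \<equiv> Bin Div a b"
abbreviation (input) less_expr (infix "\<sqsubset>" 50) where "a \<sqsubset> b \<equiv> Bin Less a b"
abbreviation (input) equal_expr (infix "\<doteq>" 50) where "a \<doteq> b \<equiv> Bin Equal a b"

abbreviation (input) "xAns \<equiv> 0 :: reg"
abbreviation (input) "xM \<equiv> 2 :: reg"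
abbreviation (input) "xDelta \<equiv> 3 :: reg"
abbreviation (input) "xSource \<equiv> 4 :: reg"
abbreviation (input) "xTarget \<equiv> 5 :: reg"
abbreviation (input) "xJ \<equiv> 6 :: reg"
abbreviation (input) "xU \<equiv> 7 :: reg"
abbreviation (input) "xV \<equiv> 8 :: reg"
abbreviation (input) "xDep \<equiv> 9 :: reg"
abbreviation (input) "xArr \<equiv> 10 :: reg"
abbreviation (input) "xSize \<equiv> 11 :: reg"
abbreviation (input) "xP \<equiv> 12 :: reg"
abbreviation (input) "xPV \<equiv> 13 :: reg"
abbreviation (input) "xQ1 \<equiv> 14 :: reg"
abbreviation (input) "xQ2 \<equiv> 15 :: reg"
abbreviation (input) "xLo \<equiv> 16 :: reg"
abbreviation (input) "xHi \<equiv> 17 :: reg"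
abbreviation (input) "xMid \<equiv> 18 :: reg"
abbreviation (input) "xS \<equiv> 19 :: reg"
abbreviation (input) "xA \<equiv> 20 :: reg"
abbreviation (input) "xX \<equiv> 21 :: reg"
abbreviation (input) "xQ \<equiv> 22 :: reg"
abbreviation (input) "xAcc \<equiv> 23 :: reg"

abbreviation (input) "aLast \<equiv> 2 :: nat"
abbreviation (input) "aCount \<equiv> 3 :: nat"
abbreviation (input) "aOut \<equiv> 4 :: nat"
abbreviation (input) "aRank \<equiv> 5 :: nat"
abbreviation (input) "aSlot \<equiv> 6 :: nat"
abbreviation (input) "aOcc \<equiv> 7 :: nat"
abbreviation (input) "aTable \<equiv> 8 :: nat"

abbreviation (input) "arc_field c \<equiv> Input (Lit 4 \<otimes> Var xJ \<oplus> Lit c)"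

text \<open>\<open>aRank\<close> keeps the index of arc \<open>j\<close> in the list of arcs leaving
  its tail, so that the next arc with the same tail is later found in constant time.\<close>

definition index_arcs :: com where
  "index_arcs =
     xJ ::= Lit 0;;
     WHILE Var xJ \<sqsubset> Var xM DO (
       xU ::= arc_field 4;;
       xV ::= arc_field 5;;
       Put aLast (Var xU) (Lit 0) (Var xJ \<oplus> Lit 1);;
       Put aLast (Var xV) (Lit 0) (Var xJ \<oplus> Lit 1);;
       Put aRank (Var xJ) (Lit 0) (Cell aCount (Var xU) (Lit 0));;
       Put aOut (Var xU) (Cell aCount (Var xU) (Lit 0)) (Var xM \<ominus> Var xJ);;
       Put aCount (Var xU) (Lit 0) (Cell aCount (Var xU) (Lit 0) \<oplus> Lit 1);;
       xJ ::= Var xJ \<oplus> Lit 1)"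

text \<open>First fit over the colours \<open>1, 2, 4, ...\<close>. Reaching \<open>xSize\<close>
  means that all opened colours are busy; then one more is opened and \<open>xSize\<close>, the
  number of colour sets, doubles.\<close>

definition assign_slot :: com where
  "assign_slot =
     IF Cell aSlot (Var xU) (Lit 0) THEN Nop ELSE (
       xP ::= Lit 1;;
       WHILE Var xJ \<sqsubset> Cell aOcc (Var xP) (Lit 0) DO xP ::= Lit 2 \<otimes> Var xP;;
       Put aOcc (Var xP) (Lit 0) (Cell aLast (Var xU) (Lit 0));;
       Put aSlot (Var xU) (Lit 0) (Var xP);;
       IF Var xP \<doteq> Var xSize THEN xSize ::= Lit 2 \<otimes> Var xSize ELSE Nop)"

definition colour_nodes :: com where
  "colour_nodes =
     xJ ::= Lit 0;;
     xSize ::= Lit 1;;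
     WHILE Var xJ \<sqsubset> Var xM DO (
       xU ::= arc_field 4;;
       assign_slot;;
       xU ::= arc_field 5;;
       assign_slot;;
       xJ ::= Var xJ \<oplus> Lit 1)"

section \<open>Reading the input\<close>

lemma nth_concat_map:
  assumes "\<And>e. e \<in> set es \<Longrightarrow> length (g e) = c" "j < length es" "r < c"
  shows "concat (map g es) ! (c * j + r) = g (es ! j) ! r"
  using assms
proof (induction es arbitrary: j)
  case (Cons e es)
  show ?case
  proof (cases j)
    case 0
    with Cons.prems show ?thesis by (simp add: nth_append)
  next
    case (Suc j')
    have "concat (map g es) ! (c * j' + r) = g (es ! j') ! r"
      using Cons.prems Suc by (intro Cons.IH) auto
    with Suc Cons.prems(1)[of e] show ?thesis by (simp add: nth_append add.assoc)
  qed
qed simp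

lemma length_encode: "length (encode es \<Delta> s t) = 4 * length es + 4"
proof -
  have "length (concat (map (\<lambda>(u, v, \<tau>, \<delta>). [u, v, \<tau>, \<delta>]) es)) = 4 * length es"
    by (induction es) auto
  then show ?thesis by (simp add: encode_def)
qed

lemma nth_encode:
  assumes "j < length es"
  shows "encode es \<Delta> s t ! (4 * j + 4) = tail (es ! j)"
    "encode es \<Delta> s t ! (4 * j + 5) = head (es ! j)"
    "encode es \<Delta> s t ! (4 * j + 6) = appearance (es ! j)"
    "encode es \<Delta> s t ! (4 * j + 7) = delay (es ! j)"
proof -
  let ?g = "\<lambda>(u, v, \<tau>, \<delta>). [u, v, \<tau>, \<delta>] :: nat list"
  have *: "encode es \<Delta> s t ! (4 * j + (4 + r)) = ?g (es ! j) ! r" if "r < 4" for r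
    using nth_concat_map[of es ?g 4 j r] assms that
    by (auto simp: encode_def nth_append)
  show "encode es \<Delta> s t ! (4 * j + 4) = tail (es ! j)"
    "encode es \<Delta> s t ! (4 * j + 5) = head (es ! j)"
    "encode es \<Delta> s t ! (4 * j + 6) = appearance (es ! j)"
    "encode es \<Delta> s t ! (4 * j + 7) = delay (es ! j)"
    using *[of 0] *[of 1] *[of 2] *[of 3] by (cases "es ! j", simp)+
qed

definition same_except :: "nat set \<Rightarrow> (nat \<Rightarrow> 'b) \<Rightarrow> (nat \<Rightarrow> 'b) \<Rightarrow> bool" where
  "same_except X R R' \<longleftrightarrow> (\<forall>r. r \<notin> X \<longrightarrow> R' r = R r)"

lemma same_except_refl [simp]: "same_except X R R"
  by (simp add: same_except_def)

lemma same_except_upd [simp]: "x \<in> X \<Longrightarrow> same_except X R R' \<Longrightarrow> same_except X R (R'(x := v))"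
  by (simp add: same_except_def)

text \<open>Row indices are node names, arc positions, colours and codes of sets, hence the demands
  on \<open>Z\<close>; the factor 20 leaves room for the sums and multiples formed from such
  numbers. The row length \<open>n + 1\<close> includes position \<open>n\<close>, "no arc".\<close>

locale ram_instance =
  machine w "\<lambda>i. encode es \<Delta> s t ! i" "4 * length es + 4" "Suc (length es)" Z +
  arc_sequence es s \<Delta>
  for w Z \<Delta> s t :: nat and es :: "nat tarc list" +
  fixes k :: nat
  assumes input_less: "x \<in> set (encode es \<Delta> s t) \<Longrightarrow> x < Z"
    and small: "m \<le> 20 * Z \<Longrightarrow> m < 2 ^ w"
    and card_live: "card (live j) \<le> k"
    and power_less: "2 ^ k < Z"
begin

lemma one_fits [simp]: "Suc 0 < 2 ^ w"
  using capacity by linarith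

lemma input_nth_less: "i < 4 * n + 4 \<Longrightarrow> encode es \<Delta> s t ! i < Z"
  using input_less[of "encode es \<Delta> s t ! i"] length_encode[of es \<Delta> s t] nth_mem by metis

lemma header: "encode es \<Delta> s t ! 0 = n" "encode es \<Delta> s t ! Suc 0 = \<Delta>"
    "encode es \<Delta> s t ! 2 = s" "encode es \<Delta> s t ! 3 = t"
  by (simp_all add: encode_def nth_append)

lemma n_less: "n < Z"
  using input_nth_less[of 0] header by simp

lemma fits_small [simp]: "(m :: nat) \<le> 20 \<Longrightarrow> m < 2 ^ w"
  using small[of m] power_less by simp

lemma index_fits:
  assumes "j < n"
  shows "4 * j < 2 ^ w" "c \<le> 7 \<Longrightarrow> 4 * j + c < 2 ^ w" "Suc j < 2 ^ w" "j < Z" "Suc (4 * j) < 4 * n" "Suc (Suc (4 * j)) < 4 * n" "Suc (Suc (Suc (4 * j))) < 4 * n"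
  using assms n_less by (simp_all add: small)

lemma arc_fields:
  assumes "j < n"
  shows "encode es \<Delta> s t ! (4 * j + 4) = src j" "encode es \<Delta> s t ! (4 * j + 5) = dst j"
    "encode es \<Delta> s t ! (4 * j + 6) = dep j" "encode es \<Delta> s t ! (4 * j + 7) = arr j - dep j"
  using nth_encode[OF assms] by (simp_all add: src_def dst_def dep_def arr_def arrival_def)

lemma arc_fields_less:
  assumes "j < n"
  shows "src j < Z" "dst j < Z" "dep j < Z" "arr j \<le> 2 * Z"
  using arc_fields[OF assms] input_nth_less[of "4 * j + 4"] input_nth_less[of "4 * j + 5"]
    input_nth_less[of "4 * j + 6"] input_nth_less[of "4 * j + 7"] assms
  by (simp_all)

section \<open>Last positions and outgoing arcs of the nodes\<close>

primrec last_upto :: "nat \<Rightarrow> nat \<Rightarrow> nat" where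
  "last_upto 0 x = 0"
| "last_upto (Suc i) x = (if endpoint x (es ! i) then Suc i else last_upto i x)"

definition outs :: "nat \<Rightarrow> nat \<Rightarrow> nat list" where
  "outs i x = filter (\<lambda>q. src q = x) [0..<i]"

lemma outs_Suc: "outs (Suc i) x = (if src i = x then outs i x @ [i] else outs i x)"
  by (simp add: outs_def)

lemma length_outs: "length (outs i x) \<le> i"
  unfolding outs_def by (metis diff_zero length_filter_le length_upt)

definition last_array :: "nat \<Rightarrow> nat \<Rightarrow> nat \<Rightarrow> nat" where
  "last_array i x c = (if c = 0 then last_upto i x else 0)"
definition count_array :: "nat \<Rightarrow> nat \<Rightarrow> nat \<Rightarrow> nat" where
  "count_array i x c = (if c = 0 then length (outs i x) else 0)"
text \<open>Position \<open>i\<close> is stored as \<open>n - i\<close>, so that cells still \<open>0\<close> stand for position \<open>n\<close>, "no arc".\<close>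

definition out_array :: "nat \<Rightarrow> nat \<Rightarrow> nat \<Rightarrow> nat" where
  "out_array i x r = (if r < length (outs i x) then n - outs i x ! r else 0)"
definition rank_array :: "nat \<Rightarrow> nat \<Rightarrow> nat \<Rightarrow> nat" where
  "rank_array i q c = (if c = 0 \<and> q < i then length (outs q (src q)) else 0)"

lemma array_0:
  "last_array 0 = (\<lambda>_ _. 0)" "count_array 0 = (\<lambda>_ _. 0)" "out_array 0 = (\<lambda>_ _. 0)"
  "rank_array 0 = (\<lambda>_ _. 0)"
  by (simp_all add: last_array_def count_array_def out_array_def rank_array_def outs_def fun_eq_iff)

lemma array_Suc:
  "last_array (Suc i) = (last_array i)(src i := (last_array i (src i))(0 := Suc i),
     dst i := (last_array i (dst i))(0 := Suc i))"
  "count_array (Suc i) = (count_array i)(src i := (count_array i (src i))(0 :=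
     Suc (count_array i (src i) 0)))"
  "out_array (Suc i) = (out_array i)(src i := (out_array i (src i))(count_array i (src i) 0 := n - i))"
  "rank_array (Suc i) = (rank_array i)(i := (rank_array i i)(0 := count_array i (src i) 0))"
  by (auto simp: last_array_def count_array_def out_array_def rank_array_def outs_Suc fun_eq_iff
      endpoint_def src_def dst_def nth_append)

lemma count_array_le: "count_array i x 0 \<le> i"
  by (simp add: count_array_def length_outs)

lemma wp_index_arcs:
  assumes "R xM = n"
    and zero: "\<And>c. c \<in> {aLast, aCount, aOut, aRank} \<Longrightarrow> A c = (\<lambda>_ _. 0)"
    and Q: "\<And>t' R' A'. t' \<le> t0 + 10 + n * 200 \<Longrightarrow> same_except {xJ, xU, xV} R R' \<Longrightarrow>
       same_except {aLast, aCount, aOut, aRank} A A' \<Longrightarrow>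
       A' aLast = last_array n \<Longrightarrow> A' aCount = count_array n \<Longrightarrow> A' aOut = out_array n \<Longrightarrow>
       A' aRank = rank_array n \<Longrightarrow> Q (t', R', A')"
  shows "wp index_arcs (t0, R, A) Q"
proof -
  \<comment> \<open>The clock is bounded by a flat charge of 200 per iteration, above the cost of
    the straight-line body; the other loops use similarly generous constants.\<close>
  define I where "I = (\<lambda>(t', R', A' :: arrays). R' xJ \<le> n \<and> t' \<le> t0 + 4 + R' xJ * 200 \<and>
    same_except {xJ, xU, xV} R R' \<and> same_except {aLast, aCount, aOut, aRank} A A' \<and>
    A' aLast = last_array (R' xJ) \<and> A' aCount = count_array (R' xJ) \<and>
    A' aOut = out_array (R' xJ) \<and> A' aRank = rank_array (R' xJ))"
  have M: "R' xM = n" if "I (t', R', A')" for t' R' A'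
    using that assms(1) by (auto simp: I_def same_except_def)
  show ?thesis
    unfolding index_arcs_def
    apply (simp add: small)
    apply (rule wp_While[where I = I and m = "\<lambda>(t, R, A). n - R xJ"])
    subgoal
      using zero by (simp add: I_def array_0)
    subgoal by simp
    subgoal premises prems for t' R' A'
    proof -
      from prems have J: "R' xJ < n" "R' xM = n" using M by (auto split: if_splits)
      show ?thesis
        using prems(1) J n_less arc_fields[OF J(1)] arc_fields_less[OF J(1)]
          count_array_le[of "R' xJ" "src (R' xJ)"]
        by (simp add: small I_def array_Suc)
    qed
    subgoal premises prems for t' R' A'
    proof -
      from prems have "R' xJ = n" using M[of t' R' A'] by (auto simp: I_def split: if_splits)
      with prems show ?thesis by (intro Q) (auto simp: I_def)
    qed
    done
qed

section \<open>Greedy interval colouring\<close>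

lemma less_last_upto_iff: "j < last_upto i x \<longleftrightarrow> (\<exists>i'<i. j \<le> i' \<and> endpoint x (es ! i'))"
  by (induction i) (auto simp: less_Suc_eq)

lemma less_last_iff_after: "j < last_upto n x \<longleftrightarrow> after j x"
  by (simp add: less_last_upto_iff after_def)

text \<open>Unlike \<open>before\<close>, this excludes position \<open>j\<close>: it describes the
  nodes handled when arc \<open>j\<close> is about to be processed.\<close>

definition seen :: "nat \<Rightarrow> nat \<Rightarrow> bool" where
  "seen j x \<longleftrightarrow> (\<exists>i<j. endpoint x (es ! i))"

text \<open>
  Colour \<open>b\<close> is represented by \<open>2\<^sup>b\<close>. The cell of \<open>2\<^sup>b\<close> in \<open>aOcc\<close> holds the last position, plus one,
  of an arc at the latest node of colour \<open>b\<close>, so the colour is free at \<open>j\<close> iff the cell is at most \<open>j\<close>.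
\<close>

definition colouring :: "nat \<Rightarrow> nat \<Rightarrow> arrays \<Rightarrow> bool" where
  "colouring K j A \<longleftrightarrow> K \<le> k \<and>
     (\<forall>x. A aSlot x 0 \<noteq> 0 \<longrightarrow> before j x \<and> (\<exists>b<K. A aSlot x 0 = 2 ^ b) \<and>
        last_upto n x \<le> A aOcc (A aSlot x 0) 0) \<and>
     (\<forall>b. A aOcc (2 ^ b) 0 \<noteq> 0 \<longrightarrow> (\<exists>x. A aSlot x 0 = 2 ^ b \<and> A aOcc (2 ^ b) 0 = last_upto n x)) \<and>
     (\<forall>x y i. A aSlot x 0 \<noteq> 0 \<longrightarrow> A aSlot x 0 = A aSlot y 0 \<longrightarrow> x \<in> live i \<longrightarrow> y \<in> live i \<longrightarrow> x = y)"

lemma colouring_mono: "colouring K j A \<Longrightarrow> j \<le> j' \<Longrightarrow> colouring K j' A"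
  unfolding colouring_def using before_mono by blast

text \<open>The cell of the first unopened colour acts as a sentinel for the first-fit scan.\<close>

lemma colouring_occ_K: "colouring K j A \<Longrightarrow> A aOcc (2 ^ K) 0 = 0"
proof (rule ccontr)
  assume c: "colouring K j A" and "A aOcc (2 ^ K) 0 \<noteq> 0"
  then obtain x where x: "A aSlot x 0 = 2 ^ K" unfolding colouring_def by blast
  then have "A aSlot x 0 \<noteq> 0" by simp
  with c obtain b where "b < K" "A aSlot x 0 = 2 ^ b" unfolding colouring_def by blast
  with x show False by simp
qed

text \<open>Pigeonhole: \<open>K\<close> busy colours belong to \<open>K\<close> different nodes
  live at \<open>j\<close>, and the uncoloured endpoint \<open>x\<close> is one more, so
  \<open>K + 1\<close> is at most the size of \<open>live j\<close>.\<close>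

lemma colouring_K_less:
  assumes c: "colouring K j A" and j: "j < n" and x: "endpoint x (es ! j)" "A aSlot x 0 = 0"
    and busy: "\<And>b. b < K \<Longrightarrow> j < A aOcc (2 ^ b) 0"
  shows "K < k"
proof -
  have "\<exists>y. A aSlot y 0 = 2 ^ b \<and> y \<in> live j" if "b < K" for b
  proof -
    from busy[OF that] have "A aOcc (2 ^ b) 0 \<noteq> 0" by simp
    with c obtain y where y: "A aSlot y 0 = 2 ^ b" "A aOcc (2 ^ b) 0 = last_upto n y"
      unfolding colouring_def by blast
    then have "A aSlot y 0 \<noteq> 0" by simp
    with c have "before j y" unfolding colouring_def by blast
    moreover have "after j y" using busy[OF that] y less_last_iff_after by simp
    ultimately show ?thesis using y by (auto simp: live_def)
  qed
  then have "\<forall>b\<in>{..<K}. \<exists>y. A aSlot y 0 = 2 ^ b \<and> y \<in> live j" by simp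
  from bchoice[OF this] obtain g where g: "\<And>b. b < K \<Longrightarrow> A aSlot (g b) 0 = 2 ^ b \<and> g b \<in> live j"
    by auto
  have "inj_on g {..<K}"
  proof (rule inj_onI)
    fix a b assume "a \<in> {..<K}" "b \<in> {..<K}" and eq: "g a = g b"
    then have "A aSlot (g a) 0 = 2 ^ a" "A aSlot (g b) 0 = 2 ^ b" using g by blast+
    then have "(2::nat) ^ a = 2 ^ b" unfolding eq by (rule trans[OF sym])
    then show "a = b" by simp
  qed
  moreover have "x \<notin> g ` {..<K}" using g x(2) by force
  ultimately have "card (insert x (g ` {..<K})) = Suc K" by (simp add: card_image)
  moreover have "insert x (g ` {..<K}) \<subseteq> live j" using g endpoint_live[OF j x(1)] by auto
  ultimately have "Suc K \<le> card (live j)" using card_mono[OF finite_live] by metis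
  then show ?thesis using card_live[of j] by simp
qed

text \<open>Earlier holders of the colour have no arc from \<open>j\<close> on, and
  \<open>x\<close>, which first occurs at \<open>j\<close>, is not live before; so they are never
  live together.\<close>

lemma colouring_assign:
  assumes c: "colouring K j A" and j: "j < n" and x: "endpoint x (es ! j)" "A aSlot x 0 = 0"
    and new: "\<not> seen j x" and free: "A aOcc (2 ^ b) 0 \<le> j" and b: "b < K'" "K \<le> K'" "K' \<le> k"
    and A': "A' aSlot = (A aSlot)(x := (A aSlot x)(0 := 2 ^ b))"
      "A' aOcc = (A aOcc)(2 ^ b := (A aOcc (2 ^ b))(0 := last_upto n x))"
  shows "colouring K' j A'"
proof -
  have x_before: "before j x" using j x by (auto simp: before_def)
  have x_last: "j < last_upto n x" using j x by (auto simp: less_last_upto_iff)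
  have x_live: "j \<le> i" if "x \<in> live i" for i
    using that new by (auto simp: live_def before_def seen_def intro: ccontr)
  have old: "before j y \<and> (\<exists>b<K. A aSlot y 0 = 2 ^ b) \<and> last_upto n y \<le> A aOcc (A aSlot y 0) 0"
    if "A aSlot y 0 \<noteq> 0" for y
    using that c unfolding colouring_def by blast
  have same: "\<not> after j y" "last_upto n y \<le> j" if "A aSlot y 0 = 2 ^ b" for y
  proof -
    show "last_upto n y \<le> j" using old[of y] that free by simp
    then show "\<not> after j y" using less_last_iff_after[of j y] by simp
  qed
  have disj: "\<not> (x \<in> live i \<and> y \<in> live i)" if "A aSlot y 0 = 2 ^ b" for y i
    using same(1)[OF that] x_live after_mono by (auto simp: live_def)
  have "before j y \<and> (\<exists>b<K'. A' aSlot y 0 = 2 ^ b) \<and> last_upto n y \<le> A' aOcc (A' aSlot y 0) 0"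
    if "A' aSlot y 0 \<noteq> 0" for y
  proof (cases "y = x")
    case True
    then show ?thesis using x_before b by (auto simp: A')
  next
    case False
    with that old[of y] have "before j y \<and> (\<exists>b<K. A aSlot y 0 = 2 ^ b) \<and> last_upto n y \<le> A aOcc (A aSlot y 0) 0"
      by (simp add: A')
    with False same(2)[of y] x_last b(2) show ?thesis
      by (auto simp: A' intro: less_le_trans)
  qed
  moreover have "\<exists>y. A' aSlot y 0 = 2 ^ b' \<and> A' aOcc (2 ^ b') 0 = last_upto n y"
    if "A' aOcc (2 ^ b') 0 \<noteq> 0" for b'
  proof (cases "b' = b")
    case True
    then show ?thesis by (intro exI[of _ x]) (simp add: A')
  next
    case False
    with that have "A aOcc (2 ^ b') 0 \<noteq> 0" by (simp add: A')
    with c obtain y where "A aSlot y 0 = 2 ^ b'" "A aOcc (2 ^ b') 0 = last_upto n y"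
      unfolding colouring_def by blast
    with False x(2) show ?thesis by (intro exI[of _ y]) (auto simp: A')
  qed
  moreover have "y = z" if "A' aSlot y 0 \<noteq> 0" "A' aSlot y 0 = A' aSlot z 0" "y \<in> live i" "z \<in> live i" for y z i
  proof (cases "y = x \<or> z = x")
    case True
    with that disj[of y i] disj[of z i] show ?thesis by (auto simp: A' split: if_splits)
  next
    case False
    with that(1,2) have "A aSlot y 0 \<noteq> 0" "A aSlot y 0 = A aSlot z 0" by (auto simp: A')
    with that(3,4) c show ?thesis unfolding colouring_def by blast
  qed
  ultimately show ?thesis using b(3) unfolding colouring_def by blast
qed

lemma power_K_less: "K \<le> k \<Longrightarrow> (2::nat) ^ K < Z"
  using power_less power_increasing[of K k "2::nat"] by linarith

lemma wp_assign_slot: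
  assumes R: "R xJ = j" "R xU = x" "R xSize = 2 ^ K" and j: "j < n" and x: "endpoint x (es ! j)" "x < Z"
    and A: "A aLast = last_array n" "colouring K j A" "\<And>y. seen j y \<Longrightarrow> A aSlot y 0 \<noteq> 0"
    and Q: "\<And>t' R' A' K'. t' \<le> t0 + 100 + k * 50 \<Longrightarrow> same_except {xP, xSize} R R' \<Longrightarrow>
       same_except {aSlot, aOcc} A A' \<Longrightarrow> R' xSize = 2 ^ K' \<Longrightarrow> colouring K' j A' \<Longrightarrow>
       A' aSlot x 0 \<noteq> 0 \<Longrightarrow> (\<And>y. A aSlot y 0 \<noteq> 0 \<Longrightarrow> A' aSlot y 0 \<noteq> 0) \<Longrightarrow> Q (t', R', A')"
  shows "wp assign_slot (t0, R, A) Q"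
proof (cases "A aSlot x 0 = 0")
  case False
  with R x A show ?thesis
    unfolding assign_slot_def by simp (intro Q, auto)
next
  case True
  have K: "K \<le> k" using A(2) by (simp add: colouring_def)
  define I where "I = (\<lambda>(t', R', A' :: arrays). A' = A \<and> same_except {xP} R R' \<and>
     (\<exists>b\<le>K. R' xP = 2 ^ b \<and> t' \<le> t0 + 20 + b * 50 \<and> (\<forall>b'<b. j < A aOcc (2 ^ b') 0)))"
  have J: "R' xJ = j" "R' xU = x" "R' xSize = 2 ^ K" if "I (t', R', A')" for t' R' A'
    using that R by (auto simp: I_def same_except_def)
  show ?thesis
    unfolding assign_slot_def
    apply (simp add: small True R x)
    apply (rule wp_While[where I = I and m = "\<lambda>(t, R, A). 2 ^ K - R xP"])
    subgoal by (auto simp: I_def intro!: exI[of _ 0])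
    subgoal for t' R' A'
      using power_K_less K unfolding I_def by (auto intro: le_less_trans[OF _ power_K_less])
    subgoal premises prems for t' R' A'
    proof -
      from prems(1) obtain b where b: "b \<le> K" "R' xP = 2 ^ b" "t' \<le> t0 + 20 + b * 50"
        "\<forall>b'<b. j < A aOcc (2 ^ b') 0" "A' = A" "same_except {xP} R R'" unfolding I_def by auto
      with prems J[OF prems(1)] have busy: "j < A aOcc (2 ^ b) 0" by (auto split: if_splits)
      with colouring_occ_K[OF A(2)] b(1) have "b < K" by (cases "b = K") auto
      then have "(2::nat) ^ b < 2 ^ K" "Suc b \<le> K" by simp_all
      moreover have "(2::nat) ^ K < Z" using K by (rule power_K_less)
      moreover have "2 * 2 ^ b \<le> (2::nat) ^ K"
        using power_increasing[OF \<open>Suc b \<le> K\<close>, of "2::nat"] by simp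
      moreover have "2 ^ K - 2 * 2 ^ b < 2 ^ K - (2::nat) ^ b"
        using \<open>2 ^ b < 2 ^ K\<close> by (intro diff_less_mono2) simp_all
      ultimately show ?thesis using b busy
        by (auto simp: small I_def less_Suc_eq intro!: exI[of _ "Suc b"])
    qed
    subgoal premises prems for t' R' A'
    proof -
      from prems(1) obtain b where b: "b \<le> K" "R' xP = 2 ^ b" "t' \<le> t0 + 20 + b * 50"
        "\<forall>b'<b. j < A aOcc (2 ^ b') 0" "A' = A" "same_except {xP} R R'" unfolding I_def by auto
      with prems J[OF prems(1)] have free: "A aOcc (2 ^ b) 0 \<le> j" by (auto split: if_splits)
      have new: "\<not> seen j x" using A(3) True by blast
      \<comment> \<open>The scan ends at \<open>b = K\<close> only if all opened colours are busy;
        \<open>colouring_K_less\<close> then leaves room for a new one.\<close>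
      define K' where "K' = (if b = K then Suc K else K)"
      have "K < k" if "b = K"
        using colouring_K_less[OF A(2) j x(1) True] b(4) that by blast
      then have K': "b < K'" "K \<le> K'" "K' \<le> k" using b(1) K by (auto simp: K'_def)
      have bZ: "2 ^ b < Z" "2 ^ K < Z" using K b(1) by (intro power_K_less; simp)+
      have size: "(if b = K then 2 * 2 ^ K else 2 ^ K) = (2::nat) ^ K'" by (simp add: K'_def)
      have bk: "b * 50 \<le> k * 50" using b(1) K by simp
      have final: "Q (t'', R'', upd (upd A aOcc (2 ^ b) 0 (last_upto n x)) aSlot x 0 (2 ^ b))"
        if "t'' \<le> t0 + 100 + k * 50" "same_except {xP, xSize} R R''" "R'' xSize = 2 ^ K'" for t'' R''
        using that by (intro Q[where K' = K'] colouring_assign[OF A(2) j x(1) True new free K'])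
          (auto simp: same_except_def)
      show ?thesis
        using J[OF prems(1)] b bZ x A(1) bk 
        apply (simp add: small last_array_def)
        apply (intro conjI impI)
        subgoal using final[of "52 + t'" "R'(xSize := 2 * 2 ^ K)"] by (auto simp: K'_def same_except_def)
        subgoal using final[of "49 + t'" R'] by (auto simp: K'_def same_except_def)
        done
    qed
    done
qed

lemma wp_colour_nodes:
  assumes "R xM = n" and A: "A aLast = last_array n"
    and zero: "A aSlot = (\<lambda>_ _. 0)" "A aOcc = (\<lambda>_ _. 0)"
    and Q: "\<And>t' R' A' K. t' \<le> t0 + 20 + n * (300 + k * 100) \<Longrightarrow>
       same_except {xJ, xU, xP, xSize} R R' \<Longrightarrow>
       same_except {aSlot, aOcc} A A' \<Longrightarrow> R' xSize = 2 ^ K \<Longrightarrow> colouring K n A' \<Longrightarrow>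
       (\<And>y. seen n y \<Longrightarrow> A' aSlot y 0 \<noteq> 0) \<Longrightarrow> Q (t', R', A')"
  shows "wp colour_nodes (t0, R, A) Q"
proof -
  define I where "I = (\<lambda>(t', R', A' :: arrays). R' xJ \<le> n \<and> t' \<le> t0 + 10 + R' xJ * (300 + k * 100) \<and>
    same_except {xJ, xU, xP, xSize} R R' \<and> same_except {aSlot, aOcc} A A' \<and>
    (\<exists>K. R' xSize = 2 ^ K \<and> colouring K (R' xJ) A') \<and>
    (\<forall>y. seen (R' xJ) y \<longrightarrow> A' aSlot y 0 \<noteq> 0))"
  have M: "R' xM = n" "A' aLast = last_array n" if "I (t', R', A')" for t' R' A'
    using that assms(1) A by (auto simp: I_def same_except_def)
  show ?thesis
    unfolding colour_nodes_def
    apply (simp add: small)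
    apply (rule wp_While[where I = I and m = "\<lambda>(t, R, A). n - R xJ"])
    subgoal
      using zero by (auto simp: I_def colouring_def seen_def intro!: exI[of _ 0])
    subgoal by simp
    subgoal premises prems for t' R' A'
    proof -
      from prems(1) obtain K where I: "t' \<le> t0 + 10 + R' xJ * (300 + k * 100)"
        "same_except {xJ, xU, xP, xSize} R R'" "same_except {aSlot, aOcc} A A'"
        "R' xSize = 2 ^ K" "colouring K (R' xJ) A'" "\<And>y. seen (R' xJ) y \<Longrightarrow> A' aSlot y 0 \<noteq> 0"
        unfolding I_def by auto
      define j where "j = R' xJ"
      from prems have j: "j < n" "R' xM = n" "A' aLast = last_array n"
        using M by (auto simp: j_def split: if_splits)
      note fields = arc_fields[OF j(1)] arc_fields_less[OF j(1)]
      note I = I[folded j_def]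
      show ?thesis
        apply (simp add: j_def[symmetric] j(1) index_fits fields)
        apply (rule wp_assign_slot[where j = j and K = K and x = "src j"])
                  apply (use I j fields in \<open>simp_all add: j_def[symmetric]\<close>)[9]
        subgoal premises p for t1 R1 A1 K1
        proof -
          have 1: "R1 xJ = j" "A1 aLast = last_array n"
            using p(2,3) j by (simp_all add: same_except_def j_def)
          have seen: "A1 aSlot y 0 \<noteq> 0" if "seen j y" for y
            using I(6)[OF that] by (rule p(7))
          show ?thesis
            apply (simp add: 1 j(1) index_fits fields)
            apply (rule wp_assign_slot[where j = j and K = K1 and x = "dst j"])
                      apply (use p j fields 1 seen in \<open>simp_all\<close>)[9]
            subgoal premises p' for t2 R2 A2 K2
            proof -
              have R2: "R2 xJ = j" using p'(2) 1 by (simp add: same_except_def)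
              have "t2 + 4 \<le> t0 + 10 + Suc j * (300 + k * 100)"
                using p'(1) p(1) I(1) by (simp add: j_def algebra_simps)
              moreover have "same_except {xJ, xU, xP, xSize} R (R2(xJ := Suc j))"
                using p'(2) p(2) I(2) by (auto simp: same_except_def)
              moreover have "same_except {aSlot, aOcc} A A2"
                using p'(3) p(3) I(3) by (auto simp: same_except_def)
              moreover have "A2 aSlot y 0 \<noteq> 0" if "seen (Suc j) y" for y
              proof -
                from that have "seen j y \<or> y = src j \<or> y = dst j"
                  by (auto simp: seen_def less_Suc_eq endpoint_def src_def dst_def)
                then show ?thesis using p'(6,7) p(6,7) I(6) unfolding j_def by blast
              qed
              moreover have "\<exists>K. R2 xSize = 2 ^ K \<and> colouring K (Suc j) A2"
                using p'(4,5) colouring_mono[of K2 j A2 "Suc j"] by auto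
              ultimately show ?thesis using R2 j(1) index_fits[OF j(1)] by (auto simp: I_def)
            qed
            done
        qed
        done
    qed
    subgoal premises prems for t' R' A'
    proof -
      from prems have "R' xJ = n" using M[of t' R' A'] by (auto simp: I_def split: if_splits)
      with prems show ?thesis by (auto simp: I_def intro: Q)
    qed
    done
qed

end

section \<open>Filling the table\<close>

text \<open>There are neither bitwise operations nor remainders; for \<open>p = 2 ^ b\<close> this
  is bit \<open>b\<close>, the parity of \<open>a div p\<close>.\<close>

definition bit_expr :: "expr \<Rightarrow> expr \<Rightarrow> expr" where
  "bit_expr a p = (a \<oslash> p) \<ominus> Lit 2 \<otimes> ((a \<oslash> p) \<oslash> Lit 2)"

definition project :: com where
  "project =
     xAcc ::= Lit 0;;
     xP ::= Lit 1;;
     WHILE Var xP \<sqsubset> Var xSize DO (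
       (IF bit_expr (Var xX) (Var xP) THEN
          IF Var xQ \<sqsubset> Cell aOcc (Var xP) (Lit 0) THEN xAcc ::= Var xAcc \<oplus> Var xP ELSE Nop
        ELSE Nop);;
       xP ::= Lit 2 \<otimes> Var xP)"

definition record_arrival :: com where
  "record_arrival =
     project;;
     IF Cell aTable (Var xAcc) (Var xQ) \<sqsubset> Var xA THEN Put aTable (Var xAcc) (Var xQ) (Var xA) ELSE Nop"

definition extend_sets :: com where
  "extend_sets =
     xS ::= Lit 0;;
     WHILE Var xS \<sqsubset> Var xSize DO (
       xA ::= Cell aTable (Var xS) (Var xJ);;
       (IF Var xA THEN (
          xX ::= Var xS;;
          xQ ::= Var xQ1;;
          record_arrival;;
          IF Var xDep \<ominus> Var xDelta \<sqsubset> Var xA THEN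
            IF bit_expr (Var xS) (Var xPV) THEN Nop ELSE (
              (IF Var xV \<doteq> Var xTarget THEN xAns ::= Lit 1 ELSE Nop);;
              xX ::= Var xS \<oplus> Var xPV;;
              xQ ::= Var xQ2;;
              xA ::= Var xArr \<oplus> Lit 1;;
              record_arrival)
          ELSE Nop)
        ELSE Nop);;
       xS ::= Var xS \<oplus> Lit 1)"

definition search_next :: com where
  "search_next =
     xLo ::= Lit 0;;
     xHi ::= Cell aCount (Var xV) (Lit 0);;
     WHILE Var xLo \<sqsubset> Var xHi DO (
       xMid ::= (Var xLo \<oplus> Var xHi) \<oslash> Lit 2;;
       IF Input (Lit 4 \<otimes> (Var xM \<ominus> Cell aOut (Var xV) (Var xMid)) \<oplus> Lit 6) \<sqsubset> Var xArr
       THEN xLo ::= Var xMid \<oplus> Lit 1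
       ELSE xHi ::= Var xMid);;
     xQ2 ::= Var xM \<ominus> Cell aOut (Var xV) (Var xLo)"

definition seed_source :: com where
  "seed_source =
     IF Var xU \<doteq> Var xSource THEN Put aTable (Var xP) (Var xJ) (Var xDep \<oplus> Lit 1) ELSE Nop"

definition setup_arc :: com where
  "setup_arc =
     xU ::= arc_field 4;;
     xV ::= arc_field 5;;
     xDep ::= arc_field 6;;
     xArr ::= Var xDep \<oplus> arc_field 7;;
     xP ::= Cell aSlot (Var xU) (Lit 0);;
     xPV ::= Cell aSlot (Var xV) (Lit 0);;
     Put aOcc (Var xP) (Lit 0) (Cell aLast (Var xU) (Lit 0));;
     Put aOcc (Var xPV) (Lit 0) (Cell aLast (Var xV) (Lit 0));;
     xQ1 ::= Var xM \<ominus> Cell aOut (Var xU) (Cell aRank (Var xJ) (Lit 0) \<oplus> Lit 1);;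
     seed_source"

definition process_arcs :: com where
  "process_arcs =
     xJ ::= Lit 0;;
     WHILE Var xJ \<sqsubset> Var xM DO (
       setup_arc;;
       search_next;;
       extend_sets;;
       xJ ::= Var xJ \<oplus> Lit 1)"

definition relax :: "(nat \<Rightarrow> nat \<Rightarrow> nat) \<Rightarrow> nat \<Rightarrow> nat \<Rightarrow> nat \<Rightarrow> nat \<Rightarrow> nat \<Rightarrow> nat" where
  "relax T y q a = T(y := (T y)(q := max (T y q) a))"

lemma le_relax: "T S q \<le> relax T y q' a S q" and relax_ge: "a \<le> relax T y q a y q"
  by (simp_all add: relax_def)

lemma relax_cases:
  assumes "relax T y q' a S q \<noteq> T S q"
  shows "S = y \<and> q = q' \<and> relax T y q' a S q = a"
  using assms by (auto simp: relax_def max_def split: if_splits)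

lemma odd_div_eq_set_decode:
  "(S div 2 ^ b) mod 2 = 0 \<longleftrightarrow> b \<notin> set_decode S"
  "(S div 2 ^ b) mod 2 = Suc 0 \<longleftrightarrow> b \<in> set_decode S"
  by (simp_all add: set_decode_def even_iff_mod_2_eq_zero odd_iff_mod_2_eq_one)

context coloured_sequence
begin

lemma table_step_0: "table_step j lst q1 q2 T 0 T"
  by (simp add: table_step_def)

lemma table_step_skip:
  assumes step: "table_step j lst q1 q2 T m T'" and zero: "T m j = 0"
  shows "table_step j lst q1 q2 T (Suc m) T'"
proof -
  have iff: "S0 < Suc m \<and> T S0 j \<noteq> 0 \<and> P \<longleftrightarrow> S0 < m \<and> T S0 j \<noteq> 0 \<and> P" for S0 P
    using zero less_Suc_eq[of S0 m] by auto
  have imp: "(S0 < Suc m \<longrightarrow> T S0 j \<noteq> 0 \<longrightarrow> P) \<longleftrightarrow> (S0 < m \<longrightarrow> T S0 j \<noteq> 0 \<longrightarrow> P)" for S0 P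
    using zero less_Suc_eq[of S0 m] by auto
  show ?thesis using step unfolding table_step_def iff imp .
qed

text \<open>Writes go to columns other than \<open>j\<close>, so updating in place still reads the
  entries of the old table.\<close>

lemma table_step_column:
  assumes "table_step j lst q1 q2 T m T'" "q1 \<noteq> j" "q2 \<noteq> j"
  shows "T' S j = T S j"
  using assms unfolding table_step_def by blast

text \<open>Since \<open>table_step\<close> records only the provenance of changed entries and lower
  bounds for targets, several sets may project to the same row: maxima only increase, and each
  changed entry keeps one source. The count \<open>m\<close> of processed rows makes it the loop
  invariant.\<close>

lemma table_step_Suc:
  assumes step: "table_step j lst q1 q2 T m T'" and m: "T m j \<noteq> 0"
    and T1: "T1 = relax T' (proj lst m q1) q1 (T m j)"
    and T2: "T2 = (if extendable j T m then relax T1 (proj lst (m + 2 ^ f (dst j)) q2) q2 (arr j + 1) else T1)"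
  shows "table_step j lst q1 q2 T (Suc m) T2"
proof -
  have le1: "T' S q \<le> T1 S q" for S q unfolding T1 by (rule le_relax)
  have le2: "T1 S q \<le> T2 S q" for S q unfolding T2 by (simp add: le_relax)
  have le0: "T S q \<le> T' S q" for S q using step unfolding table_step_def by blast
  let ?src = "\<lambda>S0 S q x. (q = q1 \<and> S = proj lst S0 q1 \<and> x = T S0 j \<or>
         extendable j T S0 \<and> q = q2 \<and> S = proj lst (S0 + 2 ^ f (dst j)) q2 \<and> x = arr j + 1)"
  have "\<exists>S0<Suc m. T S0 j \<noteq> 0 \<and> ?src S0 S q (T2 S q)" if "T2 S q \<noteq> T S q" for S q
  proof (cases "T2 S q = T1 S q")
    case False
    then have "extendable j T m \<and> S = proj lst (m + 2 ^ f (dst j)) q2 \<and> q = q2 \<and> T2 S q = arr j + 1"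
      using relax_cases[of T1 "proj lst (m + 2 ^ f (dst j)) q2" q2 "arr j + 1" S q]
      unfolding T2 by (auto split: if_splits)
    with m show ?thesis by (intro exI[of _ m]) auto
  next
    case eq: True
    show ?thesis
    proof (cases "T1 S q = T' S q")
      case False
      then have "S = proj lst m q1 \<and> q = q1 \<and> T1 S q = T m j"
        using relax_cases[of T' "proj lst m q1" q1 "T m j" S q] unfolding T1 by blast
      with m eq show ?thesis by (intro exI[of _ m]) auto
    next
      case True
      with eq that have "T' S q \<noteq> T S q" "T2 S q = T' S q" by auto
      with step obtain S0 where "S0 < m" "T S0 j \<noteq> 0" "?src S0 S q (T' S q)"
        unfolding table_step_def by blast
      with \<open>T2 S q = T' S q\<close> show ?thesis by (intro exI[of _ S0]) auto
    qed
  qed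
  moreover have "T S0 j \<le> T2 (proj lst S0 q1) q1 \<and>
        (extendable j T S0 \<longrightarrow> arr j + 1 \<le> T2 (proj lst (S0 + 2 ^ f (dst j)) q2) q2)"
    if "S0 < Suc m" "T S0 j \<noteq> 0" for S0
  proof (cases "S0 = m")
    case True
    have "T m j \<le> T1 (proj lst m q1) q1" unfolding T1 by (rule relax_ge)
    moreover have "arr j + 1 \<le> T2 (proj lst (m + 2 ^ f (dst j)) q2) q2" if "extendable j T m"
      using that relax_ge unfolding T2 by simp
    ultimately show ?thesis using True le2 le_trans by blast
  next
    case False
    then have "S0 < m" using that by simp
    with step that(2) have "T S0 j \<le> T' (proj lst S0 q1) q1"
      "extendable j T S0 \<Longrightarrow> arr j + 1 \<le> T' (proj lst (S0 + 2 ^ f (dst j)) q2) q2"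
      unfolding table_step_def by blast+
    then show ?thesis using le1 le2 le_trans by meson
  qed
  ultimately show ?thesis unfolding table_step_def using le0 le1 le2 le_trans by meson
qed

lemma proj_less: "S < 2 ^ K \<Longrightarrow> proj lst S q < 2 ^ K"
  unfolding proj_def by (rule set_encode_less) (use set_decode_less[of S K] in auto)

end

section \<open>Table updates on the machine\<close>

locale coloured_ram =
  ram_instance w Z \<Delta> s t es k + coloured_sequence es s \<Delta> f K
  for w Z \<Delta> s t :: nat and es :: "nat tarc list" and k and f :: "nat \<Rightarrow> nat" and K +
  assumes K_le: "K \<le> k"
begin

lemma power_Z: "b \<le> K \<Longrightarrow> 2 ^ b < Z"
  using K_le by (intro power_K_less) simp

lemma val_bit_expr [simp]: "val (bit_expr a p) R A = (val a R A div val p R A) mod 2"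
  by (simp add: bit_expr_def minus_mult_div_eq_mod)

lemma ok_bit_expr [simp]:
  assumes "val a R A \<le> 20 * Z"
  shows "ok (bit_expr a p) R A \<longleftrightarrow> ok a R A \<and> ok p R A"
proof -
  have "2 * (val a R A div val p R A div 2) \<le> val a R A div val p R A" by simp
  also have "\<dots> \<le> val a R A" by (rule div_le_dividend)
  finally have "2 * (val a R A div val p R A div 2) < 2 ^ w" using assms by (intro small) simp
  then show ?thesis by (simp add: bit_expr_def)
qed

lemma cost_bit_expr [simp]: "expr_cost (bit_expr a p) = 2 * expr_cost a + 2 * expr_cost p + 7"
  by (simp add: bit_expr_def)

abbreviation "occ A \<equiv> \<lambda>b. A aOcc (2 ^ b) 0"

lemma wp_project:
  assumes R: "R xSize = 2 ^ K" "R xX < 2 ^ K"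
    and Q: "\<And>t' R'. t' \<le> t0 + 20 + K * 100 \<Longrightarrow> same_except {xAcc, xP} R R' \<Longrightarrow>
      R' xAcc = proj (occ A) (R xX) (R xQ) \<Longrightarrow> Q (t', R', A)"
  shows "wp project (t0, R, A) Q"
proof -
  define G where "G b = {c \<in> set_decode (R xX). c < b \<and> R xQ < A aOcc (2 ^ c) 0}" for b
  define I where "I = (\<lambda>(t', R', A' :: arrays). A' = A \<and> same_except {xAcc, xP} R R' \<and>
     (\<exists>b\<le>K. R' xP = 2 ^ b \<and> t' \<le> t0 + 10 + b * 100 \<and> R' xAcc = set_encode (G b)))"
  have J: "R' xSize = 2 ^ K" "R' xX = R xX" "R' xQ = R xQ" if "I (t', R', A')" for t' R' A'
    using that R by (auto simp: I_def same_except_def)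
  have XZ: "R xX < Z" using R(2) power_Z[of K] by simp
  have G_less: "set_encode (G b) < 2 ^ b" for b by (rule set_encode_less) (auto simp: G_def)
  have G_Suc: "set_encode (G (Suc b)) =
      set_encode (G b) + (if b \<in> set_decode (R xX) \<and> R xQ < A aOcc (2 ^ b) 0 then 2 ^ b else 0)" for b
  proof -
    have fin: "finite (G b)" by (rule finite_subset[of _ "{..<b}"]) (auto simp: G_def)
    have "G (Suc b) = (if b \<in> set_decode (R xX) \<and> R xQ < A aOcc (2 ^ b) 0 then insert b (G b) else G b)"
      by (auto simp: G_def less_Suc_eq)
    moreover have "b \<notin> G b" by (simp add: G_def)
    ultimately show ?thesis using fin by simp
  qed
  have G_K: "set_encode (G K) = proj (occ A) (R xX) (R xQ)"
  proof -
    have "G K = {b \<in> set_decode (R xX). R xQ < A aOcc (2 ^ b) 0}"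
      using set_decode_less[OF R(2)] by (auto simp: G_def)
    then show ?thesis by (simp add: proj_def)
  qed
  show ?thesis
    unfolding project_def
    apply simp
    apply (rule wp_While[where I = I and m = "\<lambda>(t, R, A). 2 ^ K - R xP"])
    subgoal by (auto simp: I_def G_def intro!: exI[of _ 0])
    subgoal by simp
    subgoal premises prems for t' R' A'
    proof -
      from prems(1) obtain b where b: "b \<le> K" "R' xP = 2 ^ b" "t' \<le> t0 + 10 + b * 100"
        "R' xAcc = set_encode (G b)" "A' = A" "same_except {xAcc, xP} R R'" unfolding I_def by auto
      note J = J[OF prems(1)]
      from prems(2) b J have "(2::nat) ^ b < 2 ^ K" by (auto split: if_splits)
      then have bK: "b < K" by simp
      have le: "2 * 2 ^ b \<le> (2::nat) ^ K" using power_increasing[of "Suc b" K "2::nat"] bK by simp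
      have dec: "2 ^ K - 2 * 2 ^ b < 2 ^ K - (2::nat) ^ b"
        using \<open>2 ^ b < 2 ^ K\<close> by (intro diff_less_mono2) simp_all
      note KZ = power_Z[of K, simplified] power_Z[of b]
      show ?thesis
        using b(1-3,5,6) J XZ KZ le dec G_less[of b] bK
        by (auto simp: small b(4) I_def odd_div_eq_set_decode G_Suc intro!: exI[of _ "Suc b"])
    qed
    subgoal premises prems for t' R' A'
    proof -
      from prems(1) obtain b where b: "b \<le> K" "R' xP = 2 ^ b" "t' \<le> t0 + 10 + b * 100"
        "R' xAcc = set_encode (G b)" "A' = A" "same_except {xAcc, xP} R R'" unfolding I_def by auto
      from prems(2) b J[OF prems(1)] have "(2::nat) ^ K \<le> 2 ^ b" by (auto split: if_splits)
      then have "b = K" using b(1) by simp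
      with b G_K show ?thesis by (auto intro!: Q)
    qed
    done
qed

lemma wp_record_arrival:
  assumes R: "R xSize = 2 ^ K" "R xX < 2 ^ K" "R xQ \<le> n"
    and Q: "\<And>t' R' A'. t' \<le> t0 + 60 + K * 100 \<Longrightarrow> same_except {xAcc, xP} R R' \<Longrightarrow>
      same_except {aTable} A A' \<Longrightarrow>
      A' aTable = relax (A aTable) (proj (occ A) (R xX) (R xQ)) (R xQ) (R xA) \<Longrightarrow> Q (t', R', A')"
  shows "wp record_arrival (t0, R, A) Q"
  unfolding record_arrival_def
  apply simp
  apply (rule wp_project[OF R(1,2)])
  subgoal premises p for t' R'
  proof -
    define y where "y = proj (occ A) (R xX) (R xQ)"
    have "y < 2 ^ K" unfolding y_def using R(2) by (rule proj_less)
    then have y: "y < Z" using power_Z[of K] by simp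
    have R': "R' xAcc = y" "R' xQ = R xQ" "R' xA = R xA"
      using p by (simp_all add: same_except_def y_def)
    show ?thesis
      using y R(3) p(1,2)
      by (auto simp: R' relax_def max_def y_def[symmetric] intro!: Q)
  qed
  done

lemma plus_power_less:
  assumes "S < 2 ^ K" "b < K" "b \<notin> set_decode S"
  shows "S + 2 ^ b < 2 ^ K"
  unfolding plus_power_eq_set_encode[OF assms(3)]
  by (rule set_encode_less) (use assms(2) set_decode_less[OF assms(1)] in auto)

lemma wp_extend_sets:
  assumes R: "R xJ = j" "R xSize = 2 ^ K" "R xDep = dep j" "R xDelta = \<Delta>" "R xArr = arr j"
      "R xV = dst j" "R xTarget = t" "R xPV = 2 ^ f (dst j)" "R xQ1 = q1" "R xQ2 = q2"
    and j: "j < n" and q: "q1 \<le> n" "q2 \<le> n" "q1 \<noteq> j" "q2 \<noteq> j"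
    and Q: "\<And>t' R' A'. t' \<le> t0 + 20 + 2 ^ K * (400 + K * 200) \<Longrightarrow>
      same_except {xS, xA, xX, xQ, xAcc, xP, xAns} R R' \<Longrightarrow> same_except {aTable} A A' \<Longrightarrow>
      table_step j (occ A) q1 q2 (A aTable) (2 ^ K) (A' aTable) \<Longrightarrow>
      R' xAns = (if dst j = t \<and> (\<exists>S<2 ^ K. extendable j (A aTable) S) then 1 else R xAns) \<Longrightarrow>
      Q (t', R', A')"
  shows "wp extend_sets (t0, R, A) Q"
proof -
  \<comment> \<open>Each set pays for at most two projections, at 100 steps per colour each.\<close>
  define c where "c = 400 + K * 200"
  define ans where "ans S = (if dst j = t \<and> (\<exists>S'<S. extendable j (A aTable) S') then 1 else R xAns)" for S
  define I where "I = (\<lambda>(t', R', A' :: arrays). R' xS \<le> 2 ^ K \<and> t' \<le> t0 + 10 + R' xS * c \<and>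
    same_except {xS, xA, xX, xQ, xAcc, xP, xAns} R R' \<and> same_except {aTable} A A' \<and>
    table_step j (occ A) q1 q2 (A aTable) (R' xS) (A' aTable) \<and> R' xAns = ans (R' xS))"
  have J: "R' xJ = j" "R' xSize = 2 ^ K" "R' xDep = dep j" "R' xDelta = \<Delta>" "R' xArr = arr j"
      "R' xV = dst j" "R' xTarget = t" "R' xPV = 2 ^ f (dst j)" "R' xQ1 = q1" "R' xQ2 = q2"
    if "same_except {xS, xA, xX, xQ, xAcc, xP, xAns} R R'" for R'
    using that R by (simp_all add: same_except_def)
  have fd: "f (dst j) < K" using j endpoint_live[of j "dst j"] colour_less by simp
  have ans_Suc: "ans (Suc S) = (if dst j = t \<and> extendable j (A aTable) S then 1 else ans S)" for S
    by (auto simp: ans_def less_Suc_eq)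
  have pZ: "2 ^ K < Z" "2 ^ f (dst j) < Z" using power_Z fd by simp_all
  show ?thesis
    unfolding extend_sets_def
    apply simp
    apply (rule wp_While[where I = I and m = "\<lambda>(t, R, A). 2 ^ K - R xS"])
    subgoal by (simp add: I_def table_step_0 ans_def)
    subgoal by simp
    subgoal premises prems for t1 R1 A1
    proof -
      define S where "S = R1 xS"
      let ?T = "A aTable"
      from prems(1) have I: "t1 \<le> t0 + 10 + S * c"
        "same_except {xS, xA, xX, xQ, xAcc, xP, xAns} R R1" "same_except {aTable} A A1"
        "table_step j (occ A) q1 q2 ?T S (A1 aTable)" "R1 xAns = ans S"
        by (auto simp: I_def S_def)
      note J1 = J[OF I(2)]
      from prems(2) J1 have S: "S < 2 ^ K" by (auto simp: S_def split: if_splits)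
      have SZ: "S < Z" using S pZ by simp
      have col: "A1 aTable S j = ?T S j" using table_step_column[OF I(4) q(3,4)] .
      have ext: "extendable j ?T S \<longleftrightarrow> ?T S j \<noteq> 0 \<and> dep j - \<Delta> < ?T S j \<and> f (dst j) \<notin> set_decode S"
        by (simp add: extendable_def)
      have I_next: "I (t', R', A') \<and> (case (t', R', A') of (t, R, A) \<Rightarrow> 2 ^ K - R xS) < 2 ^ K - S"
        if "t' \<le> t1 + c" "same_except {xS, xA, xX, xQ, xAcc, xP, xAns} R1 R'"
          "R' xS = Suc S" "same_except {aTable} A1 A'"
          "table_step j (occ A) q1 q2 ?T (Suc S) (A' aTable)" "R' xAns = ans (Suc S)" for t' R' A'
        using that I(1-3) S by (auto simp: I_def same_except_def)
      show ?thesis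
      proof (cases "?T S j = 0")
        case True
        show ?thesis
          apply (simp add: S_def[symmetric] J1 SZ less_SucI[OF j] col True small)
          using I_next[of _ "R1(xA := 0, xS := Suc S)" A1] table_step_skip[OF I(4) True] I(5) S pZ
          apply (auto simp: same_except_def ans_Suc ext True small c_def)
          done
      next
        case False
        let ?T1 = "relax (A1 aTable) (proj (occ A) S q1) q1 (?T S j)"
        have pos: "0 < ?T S j" using False by simp
        show ?thesis
          apply (simp add: S_def[symmetric] J1 SZ less_SucI[OF j] col pos)
          apply (rule wp_record_arrival)
             apply (use S q J1 in simp_all)[3]
          subgoal premises p for t2 R2 A2
          proof -
            have R2: "R2 xS = S" "R2 xA = ?T S j" "R2 xAns = ans S"
              "same_except {xS, xA, xX, xQ, xAcc, xP, xAns} R1 R2"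
              using p(2) I(5) by (auto simp: same_except_def S_def)
            have "same_except {xS, xA, xX, xQ, xAcc, xP, xAns} R R2"
              using R2(4) I(2) by (simp add: same_except_def)
            note J2 = J[OF this]
            have A2: "A2 aTable = ?T1" "occ A2 = occ A"
              using p(3,4) I(3) by (simp_all add: same_except_def)
            show ?thesis
            proof (cases "extendable j ?T S")
              case False
              have "table_step j (occ A) q1 q2 ?T (Suc S) (A2 aTable)"
                using table_step_Suc[OF I(4) \<open>?T S j \<noteq> 0\<close> A2(1)] False by simp
              then have nxt: "I (t', R2(xS := Suc S), A2)" if "t' \<le> t1 + c" for t'
                using I_next[of t' "R2(xS := Suc S)" A2] that p(3) R2(3,4) False
                by (simp add: same_except_def ans_Suc)
              show ?thesis
                using False \<open>?T S j \<noteq> 0\<close> p(1) SZ S pZ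
                by (auto simp: R2 J2 ext odd_div_eq_set_decode small c_def intro!: nxt)
            next
              case True
              then have bit: "f (dst j) \<notin> set_decode S" "dep j - \<Delta> < ?T S j" by (simp_all add: ext)
              have less: "S + 2 ^ f (dst j) < 2 ^ K" using S fd bit(1) by (rule plus_power_less)
              have "arr j \<le> 2 * Z" using arc_fields_less[OF j] by simp
              then have fits: "Suc (arr j) < 2 ^ w" using power_less by (intro small) simp
              have second: "wp record_arrival (t3, R3, A2) (\<lambda>(t, R, A). Suc (R xS) < 2 ^ w \<and>
                  I (Suc (Suc (Suc (Suc t))), R(xS := Suc (R xS)), A) \<and>
                  2 ^ K - Suc (R xS) < 2 ^ K - S)"
                if "t3 \<le> t2 + 40" "same_except {xAns, xX, xQ, xA} R2 R3"
                  "R3 xX = S + 2 ^ f (dst j)" "R3 xQ = q2" "R3 xA = Suc (arr j)"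
                  "R3 xAns = (if dst j = t then 1 else ans S)" for t3 R3
              proof (rule wp_record_arrival)
                show "R3 xSize = 2 ^ K" using that(2) J2 by (simp add: same_except_def)
                show "R3 xX < 2 ^ K" using that(3) less by simp
                show "R3 xQ \<le> n" using that(4) q by simp
                fix t4 R4 A4
                assume r: "t4 \<le> t3 + 60 + K * 100" "same_except {xAcc, xP} R3 R4"
                  "same_except {aTable} A2 A4"
                  "A4 aTable = relax (A2 aTable) (proj (occ A2) (R3 xX) (R3 xQ)) (R3 xQ) (R3 xA)"
                have "table_step j (occ A) q1 q2 ?T (Suc S) (A4 aTable)"
                  using table_step_Suc[OF I(4) \<open>?T S j \<noteq> 0\<close> refl refl] True r(4) that(3-5) A2
                  by simp
                moreover have "R4 xS = S" using r(2) that(2) R2(1) by (simp add: same_except_def)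
                moreover have "same_except {xS, xA, xX, xQ, xAcc, xP, xAns} R1 (R4(xS := Suc S))"
                  using r(2) that(2) R2(4) by (simp add: same_except_def)
                moreover have "same_except {aTable} A1 A4" using r(3) p(3) by (simp add: same_except_def)
                moreover have "R4 xAns = ans (Suc S)"
                  using r(2) that(6) True by (simp add: same_except_def ans_Suc)
                moreover have "t4 + 4 \<le> t1 + c" using r(1) that(1) p(1) by (simp add: c_def)
                ultimately show "case (t4, R4, A4) of (t, R, A) \<Rightarrow> Suc (R xS) < 2 ^ w \<and>
                    I (Suc (Suc (Suc (Suc t))), R(xS := Suc (R xS)), A) \<and>
                    2 ^ K - Suc (R xS) < 2 ^ K - S"
                  using I_next[of "Suc (Suc (Suc (Suc t4)))" "R4(xS := Suc S)" A4] S pZ by (simp add: small)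
              qed
              show ?thesis
                using SZ pZ less bit S
                apply (simp add: R2 J2 odd_div_eq_set_decode small)
                apply (intro conjI impI fits second)
                           apply (simp_all add: same_except_def R2)
                done
            qed
          qed
          done
      qed
    qed
    subgoal premises prems for t1 R1 A1
    proof -
      from prems(1) have "R1 xS \<le> 2 ^ K" by (simp add: I_def)
      moreover have "\<not> R1 xS < 2 ^ K" using prems J[of R1] by (auto simp: I_def split: if_splits)
      ultimately have "R1 xS = 2 ^ K" by simp
      with prems(1) show ?thesis by (auto simp: I_def c_def ans_def intro!: Q)
    qed
    done
qed

section \<open>Finding the next arc that leaves a node\<close>

lemma nth_outs: "r < length (outs i x) \<Longrightarrow> outs i x ! r < i \<and> src (outs i x ! r) = x"
  using nth_mem[of r "outs i x"] by (auto simp: outs_def)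

lemma mem_outs: "q < i \<Longrightarrow> src q = x \<Longrightarrow> \<exists>r<length (outs i x). outs i x ! r = q"
  using in_set_conv_nth[of q "outs i x"] by (auto simp: outs_def)

lemma outs_less: "r < r' \<Longrightarrow> r' < length (outs i x) \<Longrightarrow> outs i x ! r < outs i x ! r'"
  using sorted_wrt_nth_less[of "(<)" "outs i x" r r'] by (simp add: outs_def sorted_wrt_filter)

lemma outs_rank:
  assumes "j < n"
  shows "length (outs j (src j)) < length (outs n (src j))"
    "outs n (src j) ! length (outs j (src j)) = j"
proof -
  have "[0..<n] = [0..<j] @ j # [Suc j..<n]"
    using assms upt_add_eq_append[of 0 j "n - j"] upt_conv_Cons[of j n] by simp
  then have "outs n (src j) = outs j (src j) @ j # filter (\<lambda>q. src q = src j) [Suc j..<n]"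
    by (simp add: outs_def)
  then show "length (outs j (src j)) < length (outs n (src j))"
    "outs n (src j) ! length (outs j (src j)) = j" by simp_all
qed

text \<open>\<open>lo\<close> may equal the length of the list: the cell there is 0, and
  \<open>n - 0\<close> is the position "no arc".\<close>

lemma is_first_outs:
  assumes "lo \<le> length (outs n x)"
    and low: "\<And>r. r < lo \<Longrightarrow> \<not> P (outs n x ! r)"
    and high: "\<And>r. lo \<le> r \<Longrightarrow> r < length (outs n x) \<Longrightarrow> P (outs n x ! r)"
  shows "is_first (\<lambda>q. src q = x \<and> P q) (n - out_array n x lo)"
proof (cases "lo < length (outs n x)")
  case True
  define q where "q = outs n x ! lo"
  have q: "q < n" "src q = x" "P q" using True nth_outs[OF True] high by (auto simp: q_def)
  have "\<not> (src i = x \<and> P i)" if "i < q" for i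
  proof
    assume i: "src i = x \<and> P i"
    with that q obtain r where r: "r < length (outs n x)" "outs n x ! r = i"
      using mem_outs[of i n x] by auto
    with low i have "lo \<le> r" by (meson not_le)
    moreover have "lo \<noteq> r" using that r by (auto simp: q_def)
    ultimately have "q < i" using outs_less[of lo r n x] r by (simp add: q_def)
    with that show False by simp
  qed
  moreover have "n - out_array n x lo = q" using True q by (simp add: out_array_def q_def)
  ultimately show ?thesis using q by (simp add: is_first_def)
next
  case False
  have "\<not> (src i = x \<and> P i)" if "i < n" for i
  proof
    assume i: "src i = x \<and> P i"
    with mem_outs[OF that] obtain r where "r < length (outs n x)" "outs n x ! r = i" by blast
    with low[of r] i False show False by simp
  qed
  with False show ?thesis by (simp add: is_first_def out_array_def)
qed

text \<open>Arc \<open>j\<close> stands in the list of its tail at the index given by the number of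
  earlier arcs with that tail, so the next list element is wanted.\<close>

lemma is_first_next:
  assumes "j < n"
  shows "is_first (\<lambda>q. j < q \<and> src q = src j) (n - out_array n (src j) (Suc (length (outs j (src j)))))"
proof -
  let ?u = "src j" and ?r = "length (outs j (src j))"
  note rank = outs_rank[OF assms]
  have "is_first (\<lambda>q. src q = ?u \<and> j < q) (n - out_array n ?u (Suc ?r))"
  proof (rule is_first_outs)
    show "Suc ?r \<le> length (outs n ?u)" using rank by simp
  next
    fix r assume "r < Suc ?r"
    then have "outs n ?u ! r \<le> j"
      using outs_less[of r ?r n ?u] rank by (cases "r = ?r") auto
    then show "\<not> j < outs n ?u ! r" by simp
  next
    fix r assume "Suc ?r \<le> r" "r < length (outs n ?u)"
    then show "j < outs n ?u ! r" using outs_less[of ?r r n ?u] rank by simp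
  qed
  then show ?thesis by (simp add: conj_commute)
qed

text \<open>Departures are sorted along the list of a node. In the invariant, arcs below
  \<open>xLo\<close> depart too early, arcs from \<open>xHi\<close> on are in time, and after
  \<open>i\<close> rounds the gap is below \<open>2 ^ (L - i)\<close>, so at most \<open>L\<close>
  rounds occur.\<close>

lemma wp_search_next:
  assumes R: "R xV = v" "R xM = n" "R xArr = a" and v: "v < Z"
    and A: "A aCount = count_array n" "A aOut = out_array n" and L: "n < 2 ^ L"
    and Q: "\<And>t' R'. t' \<le> t0 + 100 + L * 100 \<Longrightarrow> same_except {xLo, xHi, xMid, xQ2} R R' \<Longrightarrow>
      is_first (\<lambda>q. src q = v \<and> a \<le> dep q) (R' xQ2) \<Longrightarrow> Q (t', R', A)"
  shows "wp search_next (t0, R, A) Q"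
proof -
  define cnt where "cnt = length (outs n v)"
  have cnt: "cnt \<le> n" unfolding cnt_def by (rule length_outs)
  define I where "I = (\<lambda>(t', R', A' :: arrays). A' = A \<and> same_except {xLo, xHi, xMid, xQ2} R R' \<and>
    R' xLo \<le> R' xHi \<and> R' xHi \<le> cnt \<and>
    (\<forall>r<R' xLo. dep (outs n v ! r) < a) \<and>
    (\<forall>r. R' xHi \<le> r \<longrightarrow> r < cnt \<longrightarrow> a \<le> dep (outs n v ! r)) \<and>
    (\<exists>i\<le>L. R' xHi - R' xLo < 2 ^ (L - i) \<and> t' \<le> t0 + 20 + i * 100))"
  have J: "R' xV = v" "R' xM = n" "R' xArr = a" if "same_except {xLo, xHi, xMid, xQ2} R R'" for R'
    using that R by (simp_all add: same_except_def)
  show ?thesis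
    unfolding search_next_def
    apply (simp add: R v A)
    apply (rule wp_While[where I = I and m = "\<lambda>(t, R, A). R xHi - R xLo"])
    subgoal using cnt L by (auto simp: I_def cnt_def count_array_def intro!: exI[of _ 0])
    subgoal by simp
    subgoal premises prems for t1 R1 A1
    proof -
      define lo hi mid where "lo = R1 xLo" and "hi = R1 xHi" and "mid = (lo + hi) div 2"
      from prems(1) obtain i where I: "A1 = A" "same_except {xLo, xHi, xMid, xQ2} R R1"
        "hi \<le> cnt" "\<And>r. r < lo \<Longrightarrow> dep (outs n v ! r) < a"
        "\<And>r. hi \<le> r \<Longrightarrow> r < cnt \<Longrightarrow> a \<le> dep (outs n v ! r)"
        "i \<le> L" "hi - lo < 2 ^ (L - i)" "t1 \<le> t0 + 20 + i * 100"
        by (auto simp: I_def lo_def hi_def)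
      from prems(2) have lh: "lo < hi" by (auto simp: lo_def hi_def split: if_splits)
      have mid: "lo \<le> mid" "mid < hi" using lh by (auto simp: mid_def)
      have iL: "i < L"
      proof (rule ccontr)
        assume "\<not> i < L"
        with I(6,7) lh show False by simp
      qed
      then have "(2::nat) ^ (L - i) = 2 * 2 ^ (L - Suc i)"
        by (metis Suc_diff_Suc power_Suc)
      with I(7) lh have half: "hi - Suc mid < 2 ^ (L - Suc i)" "mid - lo < 2 ^ (L - Suc i)"
        by (auto simp: mid_def)
      define q where "q = outs n v ! mid"
      have q: "q < n" using mid I(3) nth_outs[of mid n v] by (simp add: q_def cnt_def)
      have out: "n - out_array n v mid = q" using mid I(3) q by (simp add: out_array_def q_def cnt_def)
      have mono: "dep (outs n v ! r) \<le> dep (outs n v ! r')" if "r \<le> r'" "r' < cnt" for r r'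
        using outs_less[of r r' n v] that nth_outs[of r' n v]
        by (cases "r = r'") (auto simp: cnt_def intro: dep_mono)
      have fits: "lo + hi < 2 ^ w" "Suc mid < 2 ^ w" "mid < Suc n"
        using lh mid I(3) cnt n_less by (simp_all add: small)
      have left: "dep (outs n v ! r) < a" if "dep q < a" "r < Suc mid" for r
        using mono[of r mid] that mid I(3) by (simp add: q_def)
      have right: "a \<le> dep (outs n v ! r)" if "\<not> dep q < a" "mid \<le> r" "r < cnt" for r
        using mono[of mid r] that by (simp add: q_def)
      show ?thesis
        apply (simp add: J[OF I(2)] I(1) A lo_def[symmetric] hi_def[symmetric] mid_def[symmetric]
            fits v out index_fits[OF q] arc_fields[OF q])
        apply (simp add: I_def I(2,3) lh mid left right lo_def[symmetric] hi_def[symmetric])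
        using mid lh I(3-6,8) half iL left right
        apply (auto intro!: exI[of _ "Suc i"])
        done
    qed
    subgoal premises prems for t1 R1 A1
    proof -
      define lo where "lo = R1 xLo"
      from prems have eq: "R1 xHi = lo" by (auto simp: I_def lo_def split: if_splits)
      from prems(1) obtain i where I: "A1 = A" "same_except {xLo, xHi, xMid, xQ2} R R1"
        "lo \<le> cnt" "\<And>r. r < lo \<Longrightarrow> dep (outs n v ! r) < a"
        "\<And>r. lo \<le> r \<Longrightarrow> r < cnt \<Longrightarrow> a \<le> dep (outs n v ! r)"
        "i \<le> L" "t1 \<le> t0 + 20 + i * 100"
        using eq by (auto simp: I_def lo_def)
      have "is_first (\<lambda>q. src q = v \<and> a \<le> dep q) (n - out_array n v lo)"
        using I(3-5) by (intro is_first_outs) (auto simp: cnt_def not_le)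
      moreover have "lo < Suc n" using I(3) cnt by simp
      moreover have "i * 100 \<le> L * 100" using I(6) by simp
      ultimately show ?thesis
        using I(2,7) by (auto simp: J[OF I(2)] I(1) A v lo_def[symmetric] intro!: Q)
    qed
    done
qed

definition prepared :: "arrays \<Rightarrow> bool" where
  "prepared A \<longleftrightarrow> A aLast = last_array n \<and> A aCount = count_array n \<and> A aOut = out_array n \<and>
     A aRank = rank_array n \<and> (\<forall>j<n. \<forall>x\<in>live j. A aSlot x 0 = 2 ^ f x)"

lemma prepared_frame: "prepared A \<Longrightarrow> same_except {aOcc, aTable} A A' \<Longrightarrow> prepared A'"
  by (simp add: prepared_def same_except_def)

definition put_last :: "nat \<Rightarrow> (nat \<Rightarrow> nat \<Rightarrow> nat) \<Rightarrow> nat \<Rightarrow> nat \<Rightarrow> nat" where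
  "put_last x g = g(2 ^ f x := (g (2 ^ f x))(0 := last_upto n x))"

lemma wp_seed_source:
  assumes R: "R xU = src j" "R xSource = s" "R xP = 2 ^ f (src j)" "R xJ = j" "R xDep = dep j"
    and j: "j < n"
    and Q: "\<And>t'. t' \<le> t0 + 30 \<Longrightarrow> Q (t', R, A(aTable := with_source j (A aTable)))"
  shows "wp seed_source (t0, R, A) Q"
proof -
  have "src j \<in> live j" using endpoint_live[OF j] by simp
  then have pZ: "2 ^ f (src j) < Z" using power_Z colour_less less_imp_le by blast
  have fits: "Suc (dep j) < 2 ^ w" using arc_fields_less[OF j] by (simp add: small)
  show ?thesis
  proof (cases "src j = s")
    case True
    have "A(aTable := with_source j (A aTable)) = upd A aTable (2 ^ f (src j)) j (dep j + 1)"
      using True by (simp add: with_source_def)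
    then show ?thesis
      using Q[of "17 + t0"] pZ fits j True R unfolding seed_source_def
      apply (simp add: R)
      done
  next
    case False
    have "A(aTable := with_source j (A aTable)) = A" using False by (simp add: with_source_def)
    then show ?thesis
      using Q[of "Suc (Suc (Suc (Suc (Suc t0))))"] False R unfolding seed_source_def
      apply (simp add: R)
      done
  qed
qed

lemma wp_setup_arc:
  assumes R: "R xJ = j" "R xM = n" "R xSource = s" and j: "j < n" and A: "prepared A"
    and Q: "\<And>t' R' A'. t' \<le> t0 + 300 \<Longrightarrow> same_except {xU, xV, xDep, xArr, xP, xPV, xQ1} R R' \<Longrightarrow>
      R' xV = dst j \<Longrightarrow> R' xDep = dep j \<Longrightarrow> R' xArr = arr j \<Longrightarrow> R' xPV = 2 ^ f (dst j) \<Longrightarrow>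
      is_first (\<lambda>q. j < q \<and> src q = src j) (R' xQ1) \<Longrightarrow>
      same_except {aOcc, aTable} A A' \<Longrightarrow> A' aTable = with_source j (A aTable) \<Longrightarrow>
      A' aOcc = put_last (dst j) (put_last (src j) (A aOcc)) \<Longrightarrow>
      Q (t', R', A')"
  shows "wp setup_arc (t0, R, A) Q"
proof -
  define q1 where "q1 = n - out_array n (src j) (Suc (length (outs j (src j))))"
  have q1: "is_first (\<lambda>q. j < q \<and> src q = src j) q1" unfolding q1_def using j by (rule is_first_next)
  have lv: "src j \<in> live j" "dst j \<in> live j" using endpoint_live[OF j] by simp_all
  then have slot: "A aSlot (src j) 0 = 2 ^ f (src j)" "A aSlot (dst j) 0 = 2 ^ f (dst j)"
    using A j by (auto simp: prepared_def)
  have pZ: "2 ^ f (src j) < Z" "2 ^ f (dst j) < Z" using lv power_Z colour_less less_imp_le by blast+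
  have rank: "rank_array n j 0 = length (outs j (src j))" using j by (simp add: rank_array_def)
  have len: "length (outs j (src j)) < n"
    using outs_rank(1)[OF j] length_outs[of n "src j"] by simp
  have last: "last_array n x 0 = last_upto n x" for x by (simp add: last_array_def)
  note F = arc_fields[OF j] arc_fields_less(1,2)[OF j] index_fits[OF j]
  have jn: "j < Suc n" using j by simp
  have arr: "dep j + (arr j - dep j) = arr j" using dep_less_arr[OF j] by simp
  have fits: "arr j < 2 ^ w" "Suc (dep j) < 2 ^ w" "Suc (length (outs j (src j))) < 2 ^ w"
    using arc_fields_less[OF j] n_less len power_less by (simp_all add: small)
  have arrays: "A aLast = last_array n" "A aOut = out_array n" "A aRank = rank_array n"
    using A by (simp_all add: prepared_def)
  have four: "3 + 4 * j < 4 * n" using j by simp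
  \<comment> \<open>Both stores into \<open>aOcc\<close> hit the same cell only if the arc is a
    loop, and then they write the same value.\<close>
  have same: "f (dst j) = f (src j) \<longleftrightarrow> dst j = src j"
    using inj_colour[of j] lv by (auto simp: inj_on_def)
  show ?thesis
    unfolding setup_arc_def
    apply (simp add: R j F jn cong: wp_cong)
    apply (simp add: arr fits slot pZ)
    apply (simp add: arrays rank fits len)
    apply (simp add: last q1_def[symmetric] four same)
    apply (intro conjI impI; rule wp_seed_source[OF _ _ _ _ _ j])
                apply (simp_all add: R)
     apply (rule Q; simp add: same_except_def put_last_def q1)+
    done
qed

text \<open>
  The array \<open>aOcc\<close> is filled a second time while the table is computed; what the colouring left
  there is overwritten before it is read at the colour of a live node.
\<close>

lemma occ_live:
  assumes j: "j < n" and x: "x \<in> live j"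
    and occ: "\<And>x. seen j x \<Longrightarrow> after j x \<Longrightarrow> g (2 ^ f x) 0 = last_upto n x"
    and g': "g' = put_last (dst j) (put_last (src j) g)"
  shows "g' (2 ^ f x) 0 = last_upto n x"
proof -
  have inj: "f x = f y \<longleftrightarrow> x = y" if "y \<in> live j" for y
    using inj_colour[of j] x that by (auto simp: inj_on_def)
  have lv: "src j \<in> live j" "dst j \<in> live j" using endpoint_live[OF j] by simp_all
  show ?thesis
  proof (cases "x = src j \<or> x = dst j")
    case True
    then show ?thesis using inj[OF lv(1)] inj[OF lv(2)] unfolding g' put_last_def by auto
  next
    case False
    then have "\<not> endpoint x (es ! j)" by (simp add: endpoint_def src_def dst_def)
    with x have "seen j x" "after j x" by (auto simp: live_def before_def seen_def le_less)
    with occ[of x] False inj[OF lv(1)] inj[OF lv(2)] show ?thesis unfolding g' put_last_def by simp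
  qed
qed

lemma wp_process_arcs:
  assumes R: "R xM = n" "R xDelta = \<Delta>" "R xSource = s" "R xTarget = t" "R xSize = 2 ^ K" "R xAns = 0"
    and A: "prepared A" "A aTable = (\<lambda>_ _. 0)" and L: "n < 2 ^ L"
    and Q: "\<And>t' R' A'. t' \<le> t0 + 20 + n * (2 ^ K * (400 + K * 200) + L * 100 + 500) \<Longrightarrow>
      R' xSource = s \<Longrightarrow> R' xTarget = t \<Longrightarrow>
      R' xAns = (if \<exists>i<n. \<exists>U. reach i U \<and> dst i = t then 1 else 0) \<Longrightarrow> Q (t', R', A')"
  shows "wp process_arcs (t0, R, A) Q"
proof -
  define c where "c = 2 ^ K * (400 + K * 200) + L * 100 + 500"
  define X where "X = {xAns, xJ, xU, xV, xDep, xArr, xP, xPV, xQ1, xQ2, xLo, xHi, xMid, xS, xA, xX, xQ, xAcc}"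
  define ans :: "nat \<Rightarrow> nat" where "ans j = (if \<exists>i<j. \<exists>U. reach i U \<and> dst i = t then 1 else 0)" for j
  \<comment> \<open>The clause on \<open>aOcc\<close> covers only nodes that still have an arc to
    come: the cell of a finished node may already belong to another node of its colour.\<close>
  define I where "I = (\<lambda>(t', R', A' :: arrays). R' xJ \<le> n \<and> t' \<le> t0 + 10 + R' xJ * c \<and>
    same_except X R R' \<and> prepared A' \<and> sound (R' xJ) (A' aTable) \<and> complete (R' xJ) (A' aTable) \<and>
    (\<forall>x. seen (R' xJ) x \<longrightarrow> after (R' xJ) x \<longrightarrow> A' aOcc (2 ^ f x) 0 = last_upto n x) \<and>
    R' xAns = ans (R' xJ))"
  have J: "R' xM = n" "R' xDelta = \<Delta>" "R' xSource = s" "R' xTarget = t" "R' xSize = 2 ^ K"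
    if "same_except X R R'" for R'
    using that R by (simp_all add: same_except_def X_def)
  show ?thesis
    unfolding process_arcs_def
    apply simp
    apply (rule wp_While[where I = I and m = "\<lambda>(t, R, A). n - R xJ"])
    subgoal
      using A R by (simp add: I_def X_def ans_def sound_def complete_def seen_def)
    subgoal by simp
    subgoal premises prems for t1 R1 A1
    proof -
      define j where "j = R1 xJ"
      let ?T = "A1 aTable"
      from prems(1) have I: "t1 \<le> t0 + 10 + j * c" "same_except X R R1" "prepared A1"
        "sound j ?T" "complete j ?T"
        "\<And>x. seen j x \<Longrightarrow> after j x \<Longrightarrow> A1 aOcc (2 ^ f x) 0 = last_upto n x" "R1 xAns = ans j"
        by (auto simp: I_def j_def)
      from prems(2) J[OF I(2)] have j: "j < n" by (auto simp: j_def split: if_splits)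
      show ?thesis
        apply (simp add: j_def[symmetric] cong: wp_cong)
        apply (rule wp_setup_arc[OF _ _ _ j I(3)])
           apply (simp_all add: j_def J[OF I(2)])[3]
        subgoal premises p for t2 R2 A2
        proof -
          have R2: "R2 xJ = j" "R2 xAns = ans j" "same_except X R R2"
            using p(2) I(2,7) by (simp_all add: same_except_def j_def X_def)
          note J2 = J[OF R2(3)]
          have A2: "prepared A2" using I(3) p(8) by (rule prepared_frame)
          \<comment> \<open>The array is right at the colours of live nodes, which is all that the
            recurrence asks of \<open>lst\<close>.\<close>
          have last: "q < occ A2 (f x) \<longleftrightarrow> after q x" if "x \<in> live j" for x q
            using occ_live[OF j that I(6) p(10)] less_last_iff_after by simp
          show ?thesis
            apply (simp cong: wp_cong)
            apply (rule wp_search_next[where L = L and v = "dst j" and a = "arr j"])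
                   apply (use p R2 J2 A2 L arc_fields_less[OF j] in \<open>simp_all add: prepared_def\<close>)[7]
            subgoal premises p' for t3 R3
            proof -
              have R3: "same_except X R R3" "R3 xJ = j" "R3 xAns = ans j" "R3 xDep = dep j"
                "R3 xArr = arr j" "R3 xV = dst j" "R3 xPV = 2 ^ f (dst j)" "R3 xQ1 = R2 xQ1"
                using p'(2) R2 p(3-6) by (simp_all add: same_except_def X_def)
              note J3 = J[OF R3(1)]
              note q1 = p(7) and q2 = p'(3)
              have ne: "R2 xQ1 \<noteq> j" "R3 xQ2 \<noteq> j"
                using q1 q2 j dep_less_arr[OF j] by (auto simp: is_first_def)
              show ?thesis
                apply (simp cong: wp_cong)
                apply (rule wp_extend_sets[where j = j])
                                  apply (rule R3 J3 refl j)+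
                    apply (use q1 q2 ne R3 in \<open>simp_all add: is_first_def\<close>)[4]
                subgoal premises p'' for t4 R4 A4
                proof -
                  have step: "table_step j (occ A2) (R2 xQ1) (R3 xQ2) (with_source j ?T) (2 ^ K) (A4 aTable)"
                    using p''(4) p(9) R3(8) by simp
                  have "sound (Suc j) (A4 aTable)"
                    by (rule sound_step[OF j I(4,5) last q1 q2 step])
                  moreover have "complete (Suc j) (A4 aTable)"
                    by (rule complete_step[OF j I(4,5) last q1 q2 step])
                  moreover have "A4 aOcc (2 ^ f x) 0 = last_upto n x" if "seen (Suc j) x" "after (Suc j) x" for x
                  proof -
                    from that(1) obtain i where "i \<le> j" "endpoint x (es ! i)"
                      by (auto simp: seen_def less_Suc_eq_le)
                    with j have "before j x" unfolding before_def by (intro exI[of _ i]) auto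
                    moreover have "after j x" using that(2) by (rule after_mono) simp
                    ultimately have "x \<in> live j" by (simp add: live_def)
                    then show ?thesis
                      using occ_live[OF j _ I(6) p(10)] p''(3) by (simp add: same_except_def)
                  qed
                  moreover have "R4 xJ = j" using p''(2) R3(2) by (simp add: same_except_def)
                  moreover have "R4 xAns = ans (Suc j)"
                    using p''(5) R3(3) reach_iff_extendable[OF j I(4,5)] p(9)
                    by (auto simp: ans_def less_Suc_eq)
                  moreover have "t4 + 4 \<le> t0 + 10 + Suc j * c"
                    using p''(1) p'(1) p(1) I(1) by (simp add: c_def algebra_simps)
                  moreover have "same_except X R R4"
                    using p''(2) R3(1) by (simp add: same_except_def X_def)
                  moreover have "prepared A4"
                    using A2 p''(3) by (auto intro: prepared_frame simp: same_except_def)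
                  ultimately show ?thesis
                    using j index_fits[OF j] by (simp add: I_def X_def flip: j_def)
                qed
                done
            qed
            done
        qed
        done
    qed
    subgoal premises prems for t1 R1 A1
    proof -
      from prems(1) have I: "R1 xJ \<le> n" "same_except X R R1" by (auto simp: I_def)
      with prems(2) J[OF I(2)] have "R1 xJ = n" by (auto split: if_splits)
      with prems(1) J[OF I(2)] show ?thesis by (auto simp: I_def c_def ans_def intro!: Q)
    qed
    done
qed

end

section \<open>The solver\<close>

definition solve :: com where
  "solve =
     xM ::= Input (Lit 0);;
     xDelta ::= Input (Lit 1);;
     xSource ::= Input (Lit 2);;
     xTarget ::= Input (Lit 3);;
     index_arcs;;
     colour_nodes;;
     process_arcs;;
     IF Var xSource \<doteq> Var xTarget THEN xAns ::= Lit 1 ELSE Nop"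

context ram_instance
begin

lemma colouring_function:
  assumes c: "colouring K n A" and seen: "\<And>y. seen n y \<Longrightarrow> A aSlot y 0 \<noteq> 0"
  shows "\<exists>f. \<forall>j. inj_on f (live j) \<and> (\<forall>x\<in>live j. f x < K \<and> A aSlot x 0 = 2 ^ f x)"
proof -
  have "\<exists>b. A aSlot x 0 \<noteq> 0 \<longrightarrow> b < K \<and> A aSlot x 0 = 2 ^ b" for x
    using c unfolding colouring_def by blast
  then have "\<exists>f. \<forall>x. A aSlot x 0 \<noteq> 0 \<longrightarrow> f x < K \<and> A aSlot x 0 = 2 ^ f x" by (intro choice) blast
  then obtain f where f: "\<And>x. A aSlot x 0 \<noteq> 0 \<Longrightarrow> f x < K \<and> A aSlot x 0 = 2 ^ f x" by blast
  have nz: "A aSlot x 0 \<noteq> 0" if "x \<in> live j" for x j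
    using that by (intro seen) (auto simp: live_def before_def seen_def)
  have "inj_on f (live j)" for j
  proof (rule inj_onI)
    fix x y assume "x \<in> live j" "y \<in> live j" "f x = f y"
    moreover from this have "A aSlot x 0 = A aSlot y 0" using f[OF nz] by metis
    ultimately show "x = y" using c nz unfolding colouring_def by blast
  qed
  with f nz show ?thesis by blast
qed

lemma wp_solve:
  assumes L: "n < 2 ^ L"
    and Q: "\<And>t' R' A'. t' \<le> 200 + n * (1000 + k * 100 + 2 ^ k * (400 + k * 200) + L * 100) \<Longrightarrow>
      R' xAns = (if s = t \<or> (\<exists>i<n. \<exists>U. reach i U \<and> dst i = t) then 1 else 0) \<Longrightarrow> Q (t', R', A')"
  shows "wp solve (0, \<lambda>_. 0, \<lambda>_ _ _. 0) Q"
proof -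
  show ?thesis
    unfolding solve_def
    apply (simp add: header cong: wp_cong)
    apply (rule wp_index_arcs)
      apply simp
     apply (simp add: fun_eq_iff)
    subgoal premises p for t1 R1 A1
    proof -
      have R1: "R1 xM = n" "R1 xDelta = \<Delta>" "R1 xSource = s" "R1 xTarget = t" "R1 xAns = 0"
        using p(2) by (simp_all add: same_except_def)
      have A1: "A1 c = (\<lambda>_ _. 0)" if "c \<notin> {aLast, aCount, aOut, aRank}" for c
        using p(3) that by (simp add: same_except_def fun_eq_iff)
      show ?thesis
        apply (simp cong: wp_cong)
        apply (rule wp_colour_nodes)
            apply (simp_all add: R1 A1 p)[4]
        subgoal premises p' for t2 R2 A2 K
        proof -
          have K: "K \<le> k" using p'(5) by (simp add: colouring_def)
          obtain f where f: "\<And>j. inj_on f (live j)" "\<And>j x. x \<in> live j \<Longrightarrow> f x < K"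
            "\<And>j x. x \<in> live j \<Longrightarrow> A2 aSlot x 0 = 2 ^ f x"
            using colouring_function[OF p'(5,6)] by blast
          interpret coloured_ram w Z \<Delta> s t es k f K
            by unfold_locales (use f K in auto)
          have R2: "R2 xM = n" "R2 xDelta = \<Delta>" "R2 xSource = s" "R2 xTarget = t" "R2 xAns = 0"
            using p'(2) R1 by (simp_all add: same_except_def)
          have A2: "prepared A2" "A2 aTable = (\<lambda>_ _. 0)"
            using p'(3) p(4-7) A1[of aTable] f(3) by (auto simp: prepared_def same_except_def)
          have pow: "2 ^ K * (400 + K * 200) \<le> 2 ^ k * (400 + k * 200)"
            using K by (intro mult_le_mono power_increasing add_mono) auto
          show ?thesis
            apply (simp cong: wp_cong)
            apply (rule wp_process_arcs[where L = L])
                    apply (simp_all add: R2 A2 L p')[9]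
            subgoal premises p'' for t3 R3 A3
            proof -
              have "t3 + 10 \<le> 200 + n * (1000 + k * 100 + 2 ^ K * (400 + K * 200) + L * 100)"
                using p''(1) p'(1) p(1) by (simp add: algebra_simps)
              also have "\<dots> \<le> 200 + n * (1000 + k * 100 + 2 ^ k * (400 + k * 200) + L * 100)"
                by (intro pow add_left_mono add_right_mono mult_le_mono2)
              finally have "t3 + 10 \<le> 200 + n * (1000 + k * 100 + 2 ^ k * (400 + k * 200) + L * 100)" .
              then show ?thesis
                using p''(2-4) by (auto intro!: Q)
            qed
            done
        qed
        done
    qed
    done
qed

end

text \<open>The prologue reads the number of arcs from cell 0 and sets register 60 to
  \<open>4 * n + 4\<close> and register 61 to \<open>n + 1\<close>; register 62 is still 0.\<close>

definition solver :: program where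
  "solver =
     Seq (Load 64 62) (Seq (Const 65 4) (Seq (Op Mul 60 64 65) (Seq (Op Add 60 60 65)
       (Seq (Const 65 1) (Seq (Op Add 61 64 65) (compile solve))))))"

context ram_instance
begin

lemma exec_solver:
  assumes L: "n < 2 ^ L"
  shows "\<exists>T \<sigma>. exec w solver (initial_state (encode es \<Delta> s t)) T \<sigma> \<and>
    answer \<sigma> = (if s = t \<or> (\<exists>i<n. \<exists>U. reach i U \<and> dst i = t) then 1 else 0) \<and>
    T \<le> 300 + n * (1000 + k * 100 + 2 ^ k * (400 + k * 200) + L * 100)"
proof -
  define M where "M = snd (initial_state (encode es \<Delta> s t))"
  define R0 R1 R2 R3 R4 R5 R6 :: "reg \<Rightarrow> nat" where
    "R0 = (\<lambda>_. 0)" and "R1 = R0(64 := n)" and "R2 = R1(65 := 4)" and "R3 = R2(60 := 4 * n)" and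
    "R4 = R3(60 := 4 * n + 4)" and "R5 = R4(65 := 1)" and "R6 = R5(61 := Suc n)"
  note defs = R0_def R1_def R2_def R3_def R4_def R5_def R6_def
  have M: "M i = encode es \<Delta> s t ! i" if "i < 4 * n + 4" for i
    using that by (simp add: M_def initial_state_def length_encode)
  have M0: "M i = 0" if "4 * n + 4 \<le> i" for i
    using that by (simp add: M_def initial_state_def length_encode)
  have fits: "n < 2 ^ w" "4 * n < 2 ^ w" "4 * n + 4 < 2 ^ w" "Suc n < 2 ^ w"
    using n_less by (simp_all add: small)
  have init: "initial_state (encode es \<Delta> s t) = (R0, M)"
    by (simp add: M_def R0_def initial_state_def)
  have "exec w (Load 64 62) (R0, M) 1 (R1, M)"
    using exec.Load[of M R0 62 w 64] M[of 0] header fits by (simp add: defs)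
  moreover have "exec w (Const 65 4) (R1, M) 1 (R2, M)"
    using exec.Const[of 4 w 65 R1 M] by (simp add: defs)
  moreover have "exec w (Op Mul 60 64 65) (R2, M) 1 (R3, M)"
    using exec.Op[of Mul R2 64 65 w 60 M] fits by (simp add: defs mult.commute)
  moreover have "exec w (Op Add 60 60 65) (R3, M) 1 (R4, M)"
    using exec.Op[of Add R3 60 65 w 60 M] fits by (simp add: defs)
  moreover have "exec w (Const 65 1) (R4, M) 1 (R5, M)"
    using exec.Const[of 1 w 65 R4 M] by (simp add: defs)
  moreover have "exec w (Op Add 61 64 65) (R5, M) 1 (R6, M)"
    using exec.Op[of Add R5 64 65 w 61 M] fits by (simp add: defs)
  \<comment> \<open>All cells behind the input are 0, which replaces any initialisation of the
    arrays.\<close>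
  moreover have rep: "represents (R6, M) (\<lambda>_. 0) (\<lambda>_ _ _. 0)"
    using M M0 loc_ge by (auto simp: represents_def defs)
  have "hl solve (0, \<lambda>_. 0, \<lambda>_ _ _. 0) (\<lambda>(t', R', A').
      t' \<le> 200 + n * (1000 + k * 100 + 2 ^ k * (400 + k * 200) + L * 100) \<and>
      R' xAns = (if s = t \<or> (\<exists>i<n. \<exists>U. reach i U \<and> dst i = t) then 1 else 0))"
    by (rule wp_sound, rule wp_solve[OF L]) auto
  then obtain T \<sigma> R' A' where 1: "exec w (compile solve) (R6, M) T \<sigma>" "represents \<sigma> R' A'"
    "T \<le> 200 + n * (1000 + k * 100 + 2 ^ k * (400 + k * 200) + L * 100)"
    "R' xAns = (if s = t \<or> (\<exists>i<n. \<exists>U. reach i U \<and> dst i = t) then 1 else 0)"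
    using rep by (rule hlE) auto
  ultimately have "exec w solver (R0, M) (1 + (1 + (1 + (1 + (1 + (1 + T)))))) \<sigma>"
    unfolding solver_def by (intro exec.Seq)
  moreover have "answer \<sigma> = R' xAns" using 1(2) by (simp add: answer_def represents_def)
  ultimately show ?thesis using 1(3,4) init by (intro exI conjI) auto
qed

end

section \<open>Live nodes and the vertex-interval-membership-width\<close>

lemma (in arc_sequence) card_live_le_vimw:
  assumes G: "point_temporal_graph V (set es)"
  shows "card (live j) \<le> vimw V (set es)"
proof (cases "live j = {}")
  case False
  then have j: "j < n" by (auto simp: live_def after_def)
  have fin: "finite V" using G by (simp add: point_temporal_graph_def)
  \<comment> \<open>An arc at \<open>x\<close> up to \<open>j\<close> makes its interval start by
    \<open>dep j\<close>, and one from \<open>j\<close> on makes it end later than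
    \<open>dep j\<close>.\<close>
  have "live j \<subseteq> active_nodes V (set es) (dep j)"
  proof
    fix x assume "x \<in> live j"
    then obtain i i' where i: "i < n" "i \<le> j" "endpoint x (es ! i)"
      and i': "i' < n" "j \<le> i'" "endpoint x (es ! i')"
      by (auto simp: live_def before_def after_def)
    have V: "x \<in> V" using G i nth_mem[OF i(1)] by (auto simp: point_temporal_graph_def endpoint_def)
    have "tau_min (set es) x \<le> dep i"
      unfolding tau_min_def dep_def setcompr_eq_image using i by (intro Min_le) auto
    then have "tau_min (set es) x \<le> dep j" using dep_mono[OF i(2) j] by simp
    moreover have "arr i' \<le> tau_max (set es) x"
      unfolding tau_max_def arr_def setcompr_eq_image using i' by (intro Max_ge) auto
    then have "dep j \<le> tau_max (set es) x" using dep_mono[OF i'(2,1)] dep_less_arr[OF i'(1)] by simp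
    ultimately show "x \<in> active_nodes V (set es) (dep j)"
      using V i by (auto simp: active_nodes_def)
  qed
  then have "card (live j) \<le> card (active_nodes V (set es) (dep j))"
    by (rule card_mono[rotated]) (use fin in \<open>simp add: active_nodes_def\<close>)
  also have "arr j \<le> lifetime (set es)"
    unfolding lifetime_def arr_def using j by (intro Max_ge) auto
  then have "dep j \<le> lifetime (set es)" using dep_less_arr[OF j] by simp
  then have "card (active_nodes V (set es) (dep j)) \<le> vimw V (set es)"
    unfolding vimw_def by (intro Max_ge) auto
  finally show ?thesis .
qed simp

text \<open>\<open>Z\<close> is the number whose logarithm is \<open>k + log 2 (2 + m)\<close>, so
  the word size condition with constant 10 says exactly \<open>Z ^ 10 \<le> 2 ^ w\<close>.\<close>

lemma ram_instanceI:
  fixes V :: "nat set"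
  assumes G: "point_temporal_graph V E" and E: "arc_listing E es"
    and w: "word_size_ok 10 (vimw V E) (encode es \<Delta> s t) w"
  shows "ram_instance w (2 ^ vimw V E * (2 + Max (set (encode es \<Delta> s t)))) \<Delta> s t es (vimw V E)"
proof -
  define k m where "k = vimw V E" and "m = Max (set (encode es \<Delta> s t))"
  define Z where "Z = 2 ^ k * (2 + m)"
  have E': "set es = E" "distinct es" "sorted (map appearance es)"
    using E by (simp_all add: arc_listing_def)
  have Z: "2 + m \<le> Z" "2 ^ k < Z"
    using mult_le_mono1[of 1 "2 ^ k" "2 + m"] by (simp_all add: Z_def)
  then have Z2: "2 \<le> Z" by simp
  have input: "x \<le> m" if "x \<in> set (encode es \<Delta> s t)" for x
    using that unfolding m_def by (intro Max_ge) auto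
  then have n: "length es \<le> m" by (auto simp: encode_def)
  have "2 powr (real k + log 2 (2 + real m)) = 2 ^ k * (2 + real m)"
    by (simp add: powr_add powr_realpow)
  then have "real Z ^ 10 = (2 powr (real k + log 2 (2 + real m))) ^ 10"
    by (simp only: Z_def of_nat_mult of_nat_power of_nat_add of_nat_numeral)
  also have "\<dots> = 2 powr (10 * (real k + log 2 (2 + real m)))"
    by (subst powr_power) auto
  also have "\<dots> \<le> 2 powr real w"
    using w by (intro powr_mono) (simp_all add: word_size_ok_def k_def m_def)
  also have "\<dots> = 2 ^ w" by (simp add: powr_realpow)
  finally have "real (Z ^ 10) \<le> real (2 ^ w)" by simp
  then have Zw: "Z ^ 10 \<le> 2 ^ w" by (simp only: of_nat_le_iff)
  \<comment> \<open>The address space grows like \<open>16 * Z ^ 2\<close>; since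
    \<open>2 \<le> Z\<close>, seven of the ten factors supply a constant 128 that absorbs all lower
    terms.\<close>
  have "2 ^ 7 * Z ^ 3 \<le> Z ^ 7 * Z ^ 3"
    using Z2 by (intro mult_le_mono power_mono) auto
  also have "\<dots> = Z ^ 10" by (simp flip: power_add)
  finally have cube: "128 * Z ^ 3 \<le> 2 ^ w" using Zw by simp
  have "Z \<le> Z * Z" "Z * Z \<le> Z ^ 3" using Z2 by (simp_all add: power3_eq_cube)
  interpret arc_sequence es s \<Delta>
    by unfold_locales (use G E' nth_mem in \<open>auto simp: point_temporal_graph_def\<close>)
  have small: "x < 2 ^ w" if "x \<le> 20 * Z" for x
    using that cube \<open>Z \<le> Z * Z\<close> \<open>Z * Z \<le> Z ^ 3\<close> Z2 by linarith
  have aux: "(b + a) * 16 + 16 + 4 * a < W" if "128 * c \<le> W" "b \<le> c" "a \<le> b" "2 \<le> a"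
    for a b c W :: nat
    using that by (simp add: add_mult_distrib)
  have "Z * Suc (length es) \<le> Z * Z" using n Z by (intro mult_le_mono) auto
  then have "(Z * Suc (length es) + Suc (length es)) * 16 + 16 + (4 * length es + 4) \<le>
      (Z * Z + Z) * 16 + 16 + 4 * Z"
    using n Z by (intro add_mono mult_le_mono) auto
  also have "\<dots> < 2 ^ w"
    using aux[OF cube \<open>Z * Z \<le> Z ^ 3\<close> \<open>Z \<le> Z * Z\<close> Z2] .
  finally have cap: "(Z * Suc (length es) + Suc (length es)) * 16 + 16 + (4 * length es + 4) < 2 ^ w" .
  have less: "x < Z" if "x \<in> set (encode es \<Delta> s t)" for x
    using input[OF that] Z by simp
  have "ram_instance w Z \<Delta> s t es k"
  proof unfold_locales
    show "Suc (length es) \<le> Z" using n Z by simp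
    show "encode es \<Delta> s t ! i < 2 ^ w" if "i < 4 * length es + 4" for i
    proof -
      have "encode es \<Delta> s t ! i < Z" using that by (intro less nth_mem) (simp add: length_encode)
      then show ?thesis by (intro small) simp
    qed
    show "card (live j) \<le> k" for j
      using card_live_le_vimw G by (simp add: k_def E')
  qed (use cap less small Z in auto)
  then show ?thesis by (simp add: Z_def k_def m_def)
qed

text \<open>For \<open>M \<noteq> 0\<close>, \<open>1 \<le> k\<close> makes
  \<open>X = k 2^k (k + log M)\<close> at least 1, so it absorbs the constants, and
  \<open>L \<le> 1 + log M \<le> k + log M\<close>. For \<open>M = 0\<close> the product vanishes
  and the constant 300 remains, which \<open>max 1\<close> accommodates.\<close>

lemma running_time_bound:
  fixes M k L T :: nat
  assumes T: "T \<le> 300 + M * (1000 + k * 100 + 2 ^ k * (400 + k * 200) + L * 100)"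
    and k: "M \<noteq> 0 \<Longrightarrow> 1 \<le> k" and L: "M \<noteq> 0 \<Longrightarrow> 2 ^ L \<le> 2 * M"
  shows "real T \<le> 3000 * max 1 (real M * real k * 2 powr real k * (real k + log 2 (real M)))"
proof (cases "M = 0")
  case True
  with T show ?thesis by simp
next
  case False
  define m p c where "m = real M" and "p = (2::real) ^ k" and "c = real k"
  define l where "l = log 2 m"
  have m: "1 \<le> m" using False by (simp add: m_def)
  then have l: "0 \<le> l" by (simp add: l_def)
  have c: "1 \<le> c" using k[OF False] by (simp add: c_def)
  have p: "1 \<le> p" by (simp add: p_def)
  have "real L = log 2 (2 ^ L)" by simp
  also have "\<dots> \<le> log 2 (2 * m)"
  proof (rule log_mono)
    have "real (2 ^ L) \<le> real (2 * M)" using L[OF False] by (simp only: of_nat_le_iff)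
    then show "2 ^ L \<le> 2 * m" by (simp add: m_def)
  qed auto
  also have "\<dots> = 1 + l" using m by (simp add: log_mult l_def)
  finally have L': "real L \<le> c + l" using c by simp
  define X where "X = c * p * (c + l)"
  have cl: "1 \<le> c + l" using c l by simp
  have cp: "c \<le> c * p" "p \<le> c * p" "1 \<le> c * p"
    using mult_mono[of 1 c 1 p] mult_mono[of c c 1 p] mult_mono[of 1 c p p] c p by simp_all
  have "c * p * 1 \<le> X" unfolding X_def using c p cl by (intro mult_left_mono) auto
  then have X: "1 \<le> X" "c \<le> X" "p \<le> X" "c * p \<le> X" using cp by linarith+
  have "1 * (c + l) \<le> X" unfolding X_def using cp cl by (intro mult_right_mono) auto
  with L' have LX: "real L \<le> X" by simp
  have "real T \<le> 300 + m * (1000 + c * 100 + p * (400 + c * 200) + real L * 100)"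
    using of_nat_mono[OF T, where 'a = real] by (simp add: m_def c_def p_def)
  \<comment> \<open>The coefficient 600 collects \<open>400 * p\<close> and
    \<open>200 * (c * p)\<close>.\<close>
  also have "\<dots> \<le> 300 * m + m * (1000 * X + 100 * X + 600 * X + 100 * X)"
    using m X LX by (intro add_mono mult_left_mono) (simp_all add: algebra_simps)
  also have "\<dots> \<le> 3000 * (m * X)"
  proof -
    have "m * 1 \<le> m * X" using m X by (intro mult_left_mono) auto
    moreover have "m * (1000 * X + 100 * X + 600 * X + 100 * X) = 1800 * (m * X)"
      by (simp add: algebra_simps)
    ultimately show ?thesis using m by linarith
  qed
  also have "m * X = real M * real k * 2 powr real k * (real k + log 2 (real M))"
    by (simp add: X_def m_def c_def p_def l_def powr_realpow mult.assoc)
  finally show ?thesis by simp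
qed

theorem theorem2:
  shows "\<exists>(P :: program) (C :: real) (c :: nat).
    \<forall>(V :: nat set) (E :: nat tarc set) (s :: nat) (t :: nat) (\<Delta> :: nat) (es :: nat tarc list) (w :: nat).
      point_temporal_graph V E \<longrightarrow> s \<in> V \<longrightarrow> t \<in> V \<longrightarrow> arc_listing E es \<longrightarrow>
      word_size_ok c (vimw V E) (encode es \<Delta> s t) w \<longrightarrow>
      (\<exists>T \<sigma>. exec w P (initial_state (encode es \<Delta> s t)) T \<sigma> \<and>
        answer \<sigma> = (if \<exists>p. temporal_path E s t p \<and> restless \<Delta> p then 1 else 0) \<and>
        (let M = real (card E); k = real (vimw V E) in
          real T \<le> C * max 1 (M * k * 2 powr k * (k + log 2 M))))"
proof (rule exI[of _ solver], rule exI[of _ 3000], rule exI[of _ 10], intro allI impI)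
  fix V :: "nat set" and E :: "nat tarc set" and s t \<Delta> :: nat and es :: "nat tarc list" and w :: nat
  assume G: "point_temporal_graph V E" and E: "arc_listing E es"
    and w: "word_size_ok 10 (vimw V E) (encode es \<Delta> s t) w"
  interpret ram_instance w "2 ^ vimw V E * (2 + Max (set (encode es \<Delta> s t)))" \<Delta> s t es "vimw V E"
    using G E w by (rule ram_instanceI)
  have E': "set es = E" "card E = n" using E distinct_card by (auto simp: arc_listing_def)
  \<comment> \<open>\<open>L\<close> is the binary length of \<open>n\<close>; it occurs in the
    analysis only and is never computed by the program.\<close>
  obtain L where L: "n < 2 ^ L" "n \<noteq> 0 \<Longrightarrow> 2 ^ L \<le> 2 * n"
  proof (cases "n = 0")
    case True
    then show ?thesis using that[of 0] by simp
  next
    case False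
    then have "1 \<le> n" by (cases es) auto
    then obtain l where "2 ^ l \<le> n" "n < 2 ^ (l + 1)"
      using ex_power_ivl1[of 2 n] by auto
    then show ?thesis using that[of "Suc l"] by simp
  qed
  \<comment> \<open>The tail of the first arc is live at position 0.\<close>
  have k: "1 \<le> vimw V E" if "n \<noteq> 0"
  proof -
    have "src 0 \<in> live 0" using that endpoint_live[of 0 "src 0"] by simp
    then have "card (live 0) \<noteq> 0" using finite_live by auto
    with card_live[of 0] show ?thesis by simp
  qed
  from exec_solver[OF L(1)] obtain T \<sigma> where
    T: "exec w solver (initial_state (encode es \<Delta> s t)) T \<sigma>"
      "T \<le> 300 + n * (1000 + vimw V E * 100 + 2 ^ vimw V E * (400 + vimw V E * 200) + L * 100)"
    and ans: "answer \<sigma> = (if s = t \<or> (\<exists>i<n. \<exists>U. reach i U \<and> dst i = t) then 1 else 0)"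
    by blast
  have "answer \<sigma> = (if \<exists>p. temporal_path E s t p \<and> restless \<Delta> p then 1 else 0)"
    using ans restless_path_iff[of t] unfolding E' by simp
  moreover have "let M = real (card E); k = real (vimw V E) in
      real T \<le> 3000 * max 1 (M * k * 2 powr k * (k + log 2 M))"
    unfolding Let_def E' by (rule running_time_bound[OF T(2) k L(2)])
  ultimately show "\<exists>T \<sigma>. exec w solver (initial_state (encode es \<Delta> s t)) T \<sigma> \<and>
        answer \<sigma> = (if \<exists>p. temporal_path E s t p \<and> restless \<Delta> p then 1 else 0) \<and>
        (let M = real (card E); k = real (vimw V E) in
          real T \<le> 3000 * max 1 (M * k * 2 powr k * (k + log 2 M)))"
    using T(1) by blast
qed

end
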